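(* For every frequency $\lambda$ $$H_{\infty,0}^{\lambda}[\mathrm{Re}>0]=H_{\infty}^{\lambda}[\mathrm{Re}>0].$$
   Context: A frequency is a strictly increasing sequence $\lambda=(\lambda_n)_{n\ge 1}$ of non-negative real numbers with $\lambda_n\to\infty$. A $\lambda$-Dirichlet series is a formal series $D=\sum a_n e^{-\lambda_n s}$ with complex coefficients $a_n$. Write $[\mathrm{Re}>\sigma]=\{s\in\mathbb{C}:\mathrm{Re}\,s>\sigma\}$. A $\lambda$-Dirichlet series $D=\sum a_ne^{-\lambda_ns}$ is a $\lambda$-Riesz germ of a holomorphic function $f:[\mathrm{Re}>0]\to\mathbb{C}$ if for some $m\ge 0$ and some $\sigma\ge 0$ one has $f(s)=\lim_{x\to\infty}\sum_{\lambda_n<x}a_ne^{-\lambda_ns}\big(1-\frac{\lambda_n}{x}\big)^m$ for all $s\in[\mathrm{Re}>\sigma]$. $H_{\infty,0}^{\lambda}[\mathrm{Re}>0]$ is the linear space of all bounded holomorphic $f:[\mathrm{Re}>0]\to\mathbb{C}$ which have a $\lambda$-Riesz germ, with norm $\|f\|_{\infty,0}=\sup_{\mathrm{Re}\,s>0}|f(s)|$. $H_{\infty}^{\lambda}[\mathrm{Re}>0]$ is the linear space, also with the sup norm on $[\mathrm{Re}>0]$, of all bounded holomorphic functions $f:[\mathrm{Re}>0]\to\mathbb{C}$ such that for every $\sigma>0$ the function $t\mapsto f(\sigma+it)$ is uniformly almost periodic on $\mathbb{R}$ (i.e. a uniform limit on $\mathbb{R}$ of finite linear combinations of functions $t\mapsto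 e^{-i\alpha t}$, $\alpha\in\mathbb{R}$), and whose Bohr coefficients $a_x(f)=\lim_{T\to\infty}\frac{1}{2T}\int_{-T}^{T}f(\sigma+it)e^{(\sigma+it)x}\,dt$, $x\in\mathbb{R}$ (which do not depend on the choice of $\sigma>0$), vanish for all $x\notin\{\lambda_n:n\in\mathbb{N}\}$. *)

theory Defs
  imports "HOL-Complex_Analysis.Complex_Analysis"
begin

text \<open>Sequences are indexed by \<open>nat\<close> starting at 0, so \<open>l n\<close> is the
  frequency \<open>\<lambda>\<close> at index \<open>n + 1\<close>.\<close>

definition frequency :: "(nat \<Rightarrow> real) \<Rightarrow> bool" where
  "frequency l \<longleftrightarrow>
     strict_mono l \<and> (\<forall>n. 0 \<le> l n) \<and> filterlim l at_top sequentially"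

definition right_half_plane :: "real \<Rightarrow> complex set" where
  "right_half_plane \<sigma> = {s. \<sigma> < Re s}"

text \<open>A formal \<open>\<lambda>\<close>-Dirichlet series is given by its coefficient sequence \<open>a\<close>.
  The order \<open>m\<close> is real. For a frequency \<open>l\<close> the index set is finite and every
  base \<open>1 - l n / x\<close> in the sum is positive, so \<open>powr\<close> is the ordinary power.\<close>

definition riesz_mean ::
    "(nat \<Rightarrow> real) \<Rightarrow> (nat \<Rightarrow> complex) \<Rightarrow> real \<Rightarrow> real \<Rightarrow> complex \<Rightarrow> complex" where
  "riesz_mean l a m x s =
     (\<Sum>n | l n < x. a n * exp (- of_real (l n) * s) * of_real ((1 - l n / x) powr m))"

definition riesz_germ ::
    "(nat \<Rightarrow> real) \<Rightarrow> (nat \<Rightarrow> complex) \<Rightarrow> (complex \<Rightarrow> complex) \<Rightarrow> bool" where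
  "riesz_germ l a f \<longleftrightarrow>
     f holomorphic_on right_half_plane 0 \<and>
     (\<exists>m\<ge>0. \<exists>\<sigma>\<ge>0. \<forall>s\<in>right_half_plane \<sigma>.
        ((\<lambda>x. riesz_mean l a m x s) \<longlongrightarrow> f s) at_top)"

text \<open>Functions on \<open>[Re > 0]\<close> are represented by total functions whose values
  outside \<open>[Re > 0]\<close> are unconstrained. Both spaces below depend only on the
  restriction to \<open>[Re > 0]\<close>, and both carry the pointwise linear structure and the
  supremum norm over \<open>[Re > 0]\<close>, so they agree as normed spaces iff they agree as sets.\<close>

definition H_inf_0 :: "(nat \<Rightarrow> real) \<Rightarrow> (complex \<Rightarrow> complex) set" where
  "H_inf_0 l =
     {f. f holomorphic_on right_half_plane 0 \<and>
         bounded (f ` right_half_plane 0) \<and>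
         (\<exists>a. riesz_germ l a f)}"

definition trig_polynomial :: "(real \<Rightarrow> complex) \<Rightarrow> bool" where
  "trig_polynomial p \<longleftrightarrow>
     (\<exists>A c. finite A \<and> p = (\<lambda>t. \<Sum>\<alpha>\<in>A. c \<alpha> * exp (- \<i> * of_real \<alpha> * of_real t)))"

definition uniformly_almost_periodic :: "(real \<Rightarrow> complex) \<Rightarrow> bool" where
  "uniformly_almost_periodic g \<longleftrightarrow>
     (\<exists>p. (\<forall>n::nat. trig_polynomial (p n)) \<and> uniform_limit UNIV p g sequentially)"

text \<open>The limit exists whenever \<open>t \<mapsto> f (\<sigma> + i t)\<close> is uniformly almost periodic;
  the coefficient is only used in that situation.\<close>

definition bohr_coeff :: "(complex \<Rightarrow> complex) \<Rightarrow> real \<Rightarrow> real \<Rightarrow> complex" where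
  "bohr_coeff f \<sigma> x =
     Lim at_top (\<lambda>T::real. of_real (1 / (2 * T)) *
       integral {-T..T} (\<lambda>t. f (Complex \<sigma> t) * exp (Complex \<sigma> t * of_real x)))"

text \<open>As the coefficients do not depend on \<open>\<sigma>\<close>, requiring them to vanish for every
  \<open>\<sigma> > 0\<close> is the same as requiring it for one \<open>\<sigma> > 0\<close>.\<close>

definition H_inf :: "(nat \<Rightarrow> real) \<Rightarrow> (complex \<Rightarrow> complex) set" where
  "H_inf l =
     {f. f holomorphic_on right_half_plane 0 \<and>
         bounded (f ` right_half_plane 0) \<and>
         (\<forall>\<sigma>>0. uniformly_almost_periodic (\<lambda>t. f (Complex \<sigma> t))) \<and>
         (\<forall>\<sigma>>0. \<forall>x. x \<notin> range l \<longrightarrow> bohr_coeff f \<sigma> x = 0)}"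

end

theory Submission
  imports Defs "HOL-Probability.Sinc_Integral"
begin

text \<open>Convolve \<open>f\<close> along vertical lines with a rescaled power of the Fejer kernel; its Fourier
  transform has compact support, so on a series only finitely many terms survive.

  If \<open>f\<close> is almost periodic on vertical lines, the convolution with the Fejer kernel itself is
  almost periodic on \<open>Re s = 1\<close> and has the same Bohr coefficients as a Riesz mean of order \<open>1\<close>, so
  the uniqueness theorem for almost periodic functions identifies the two.

  Conversely, let the Riesz means of order \<open>m\<close> converge to \<open>f\<close> in some half plane. Raising \<open>m\<close> to an
  integer \<open>k\<close>, they grow at most like \<open>\<bar>s\<bar>\<^sup>k\<^sup>+\<^sup>1\<close> on vertical lines. Against a kernel of sufficiently
  fast decay the convolution is therefore computed term by term and is a Dirichlet polynomial.

  Either identity extends from one vertical line to \<open>Re s > 0\<close> by analytic continuation, where \<open>f\<close>,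
  being Lipschitz on \<open>Re s \<ge> \<sigma>\<close> for all \<open>\<sigma> > 0\<close>, is the limit of its convolutions, uniformly
  on vertical lines.\<close>

subsection \<open>The Fejer kernel\<close>

text \<open>Exponentials are eigenfunctions of this averaging: moving s by i u / X multiplies e^(-l
  s) by e^(-i l u / X), so the average multiplies the term of frequency l by the Fourier transform
  of the kernel at l / X. For the Fejer kernel the multiplier is max 0 (1 - |l| / X), which for l >=
  0 is the Riesz weight of order 1. Hence a function with the right spectrum gets a germ of order 1
  that converges on all of Re s > 0. The converse starts from much less: a germ of unknown order
  that converges pointwise and perhaps only far to the right. Its Riesz means need a majorant before
  the limit can be taken under the averaging integral, and the available bound along vertical lines
  grows too fast for the quadratic decay of the Fejer kernel. A high power of the kernel cures this.
  Its transform is no longer computed, but here only the support matters. Boundedness of f makes the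
  averages of f itself holomorphic on all of Re s > 0, where the series is not known to be
  summable.\<close>

definition fejer :: "real \<Rightarrow> real" where
  "fejer u = (if u = 0 then 1 / 2 else (1 - cos u) / u\<^sup>2)"

text \<open>The entire extension of \<open>fejer\<close>, needed to move contours off the real
  axis.\<close>

definition cfejer :: "complex \<Rightarrow> complex" where
  "cfejer z = (if z = 0 then 1 / 2 else (1 - cos z) / z\<^sup>2)"

lemma cfejer_of_real: "cfejer (of_real u) = of_real (fejer u)"
  by (simp add: fejer_def cfejer_def cos_of_real)

lemma cfejer_holomorphic: "cfejer holomorphic_on UNIV"
proof (rule no_isolated_singularity[where K = "{0}"])
  show hol: "cfejer holomorphic_on UNIV - {0}"
    by (rule holomorphic_transform[where f = "\<lambda>z. (1 - cos z) / z\<^sup>2"])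
       (auto simp: cfejer_def intro!: holomorphic_intros)
  \<comment> \<open>The half-angle formula 1 - cos z = 2 sin(z / 2)^2 reduces the limit at the
    removable singularity to this one.\<close>
  have "((\<lambda>z::complex. sin z / z) \<longlongrightarrow> 1) (at 0)"
    using DERIV_sin[of "0::complex"] by (simp add: has_field_derivative_iff)
  moreover have "filterlim (\<lambda>z::complex. z / 2) (at 0) (at 0)"
    by (auto simp: filterlim_at eventually_at intro!: tendsto_eq_intros exI[of _ 1])
  ultimately have "((\<lambda>z::complex. sin (z / 2) / (z / 2)) \<longlongrightarrow> 1) (at 0)"
    by (rule filterlim_compose)
  then have "((\<lambda>z::complex. (sin (z / 2) / (z / 2))\<^sup>2 / 2) \<longlongrightarrow> 1\<^sup>2 / 2) (at 0)"
    by (intro tendsto_intros) auto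
  moreover have "(sin (z / 2) / (z / 2))\<^sup>2 / 2 = cfejer z" if "z \<noteq> 0" for z :: complex
    using that cos_double_sin[of "z / 2"] by (simp add: cfejer_def power2_eq_square field_simps)
  ultimately have "(cfejer \<longlongrightarrow> 1 / 2) (at 0)"
    by (subst tendsto_cong[where g = "\<lambda>z. (sin (z / 2) / (z / 2))\<^sup>2 / 2"])
       (auto simp: eventually_at intro!: exI[of _ 1])
  then have "isCont cfejer 0"
    by (simp add: isCont_def cfejer_def)
  moreover have "isCont cfejer z" if "z \<noteq> 0" for z
    using holomorphic_on_imp_continuous_on[OF hol] that
    by (auto simp: continuous_on_eq_continuous_at open_delete)
  ultimately show "continuous_on UNIV cfejer"
    by (metis continuous_at_imp_continuous_on)
qed auto

lemma fejer_continuous [continuous_intros]: "continuous_on A fejer"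
proof -
  have "continuous_on UNIV (\<lambda>u. Re (cfejer (of_real u)))"
    by (intro continuous_intros continuous_on_compose2[OF holomorphic_on_imp_continuous_on[OF cfejer_holomorphic]]) auto
  then show ?thesis
    using continuous_on_subset by (fastforce simp: cfejer_of_real)
qed

lemma fejer_measurable [measurable]: "fejer \<in> borel_measurable borel"
  by (intro borel_measurable_continuous_onI continuous_intros)

lemma fejer_nonneg: "0 \<le> fejer u"
  by (simp add: fejer_def)

lemma fejer_minus [simp]: "fejer (- u) = fejer u"
  by (simp add: fejer_def)

lemma fejer_le: "fejer u \<le> 5 / 2 / (1 + u\<^sup>2)"
proof (cases "u = 0")
  case False
  have "1 - cos u = 2 * (sin (u / 2))\<^sup>2"
    using cos_double_sin[of "u / 2"] by simp
  moreover have "(sin (u / 2))\<^sup>2 \<le> (u / 2)\<^sup>2"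
    using abs_sin_x_le_abs_x[of "u / 2"] by (metis abs_le_square_iff)
  ultimately have "1 - cos u \<le> u\<^sup>2 / 2"
    by (simp add: power_divide)
  moreover have "1 - cos u \<le> 2"
    using cos_ge_minus_one[of u] by linarith
  \<comment> \<open>One bound is good near 0, the other at infinity. Weighted to add up to 2 (1 -
    cos u) (1 + u^2) <= 5 u^2, they give the constant 5 / 2.\<close>
  ultimately have "2 * (1 - cos u) + 2 * ((1 - cos u) * u\<^sup>2) \<le> u\<^sup>2 + 2 * (2 * u\<^sup>2)"
    by (intro add_mono mult_left_mono mult_right_mono) auto
  then show ?thesis
    using False by (simp add: fejer_def field_simps add_pos_nonneg)
qed (simp add: fejer_def)

lemma integrable_inverse_1_plus_square_lborel: "integrable lborel (\<lambda>u::real. 1 / (1 + u\<^sup>2))"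
  using integrable_inverse_1_plus_square by (simp add: set_integrable_def inverse_eq_divide)

text \<open>M - 1 of the M factors absorb (1 + |u|)^j, since j <= 2 (M - 1), and the remaining one
  leaves the integrable 1 / (1 + u^2).\<close>

lemma integrable_power_fejer:
  assumes "Suc j < 2 * M"
  shows "integrable lborel (\<lambda>u. (1 + \<bar>u\<bar>) ^ j * fejer u ^ M)"
proof (rule Bochner_Integration.integrable_bound[OF
      integrable_mult_right[OF integrable_inverse_1_plus_square_lborel, of "2 ^ (M - 1) * (5 / 2) ^ M"]])
  have "norm ((1 + \<bar>u\<bar>) ^ j * fejer u ^ M)
      \<le> norm (2 ^ (M - 1) * (5 / 2) ^ M * (1 / (1 + u\<^sup>2)))" for u :: real
  proof -
    have "(1 + \<bar>u\<bar>)\<^sup>2 \<le> 2 * (1 + u\<^sup>2)"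
      using sum_squares_bound[of 1 "\<bar>u\<bar>"] by (simp add: power2_eq_square algebra_simps)
    then have "((1 + \<bar>u\<bar>)\<^sup>2) ^ (M - 1) \<le> (2 * (1 + u\<^sup>2)) ^ (M - 1)"
      by (intro power_mono) auto
    moreover have "(1 + \<bar>u\<bar>) ^ j \<le> (1 + \<bar>u\<bar>) ^ (2 * (M - 1))"
      using assms by (intro power_increasing) auto
    ultimately have 1: "(1 + \<bar>u\<bar>) ^ j \<le> (2 * (1 + u\<^sup>2)) ^ (M - 1)"
      by (simp add: power_mult)
    have 2: "fejer u ^ M \<le> (5 / 2 / (1 + u\<^sup>2)) ^ M"
      by (intro power_mono fejer_le fejer_nonneg)
    have "(1 + \<bar>u\<bar>) ^ j * fejer u ^ M \<le> (2 * (1 + u\<^sup>2)) ^ (M - 1) * (5 / 2 / (1 + u\<^sup>2)) ^ M"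
      using 1 2 by (intro mult_mono) (auto simp: fejer_nonneg)
    also have "\<dots> = 2 ^ (M - 1) * (5 / 2) ^ M * (1 / (1 + u\<^sup>2))"
    proof -
      define A where "A = 1 + u\<^sup>2"
      have "A \<noteq> 0"
        unfolding A_def by (smt (verit) zero_le_power2)
      moreover have "A ^ M = A ^ (M - 1) * A"
        using assms by (cases M) auto
      ultimately show ?thesis
        unfolding A_def[symmetric] by (simp add: power_mult_distrib power_divide)
    qed
    finally show ?thesis
      by (simp add: fejer_nonneg)
  qed
  then show "AE u in lborel. norm ((1 + \<bar>u\<bar>) ^ j * fejer u ^ M)
      \<le> norm (2 ^ (M - 1) * (5 / 2) ^ M * (1 / (1 + u\<^sup>2)))"
    by auto
qed simp

lemma integrable_fejer_power: "0 < M \<Longrightarrow> integrable lborel (\<lambda>u. fejer u ^ M)"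
  using integrable_power_fejer[of 0 M] by simp

text \<open>Contour arguments yield gauge integrals over [-R, R], while \<open>transform\<close> is
  a Lebesgue integral over the line; this links the two.\<close>

lemma integral_symmetric_tendsto:
  fixes f :: "real \<Rightarrow> complex"
  assumes "integrable lborel f"
  shows "((\<lambda>R. integral {-R..R} f) \<longlongrightarrow> integral\<^sup>L lborel f) at_top"
proof -
  have [measurable]: "f \<in> borel_measurable borel"
    using assms by auto
  have "((\<lambda>R. LINT u|lborel. indicator {-R..R} u *\<^sub>R f u) \<longlongrightarrow> integral\<^sup>L lborel f) at_top"
  proof (rule integral_dominated_convergence_at_top[where w = "\<lambda>u. norm (f u)"])
    show "AE u in lborel. ((\<lambda>R. indicator {-R..R} u *\<^sub>R f u) \<longlongrightarrow> f u) at_top"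
    proof (intro AE_I2 tendsto_eventually)
      fix u
      show "\<forall>\<^sub>F R in at_top. indicator {- R..R} u *\<^sub>R f u = f u"
        using eventually_ge_at_top[of "\<bar>u\<bar>"]
        by eventually_elim (auto simp: indicator_def)
    qed
  qed (auto simp: assms indicator_def)
  moreover have "(LINT u|lborel. indicator {-R..R} u *\<^sub>R f u) = integral {-R..R} f" for R
  proof -
    have "set_integrable lborel {-R..R} f"
      unfolding set_integrable_def by (intro integrable_mult_indicator assms) auto
    from set_borel_integral_eq_integral(2)[OF this] show ?thesis
      by (simp add: set_lebesgue_integral_def)
  qed
  ultimately show ?thesis
    by simp
qed

section \<open>Fourier transforms of the powers of the Fejer kernel\<close>

text \<open>The Fourier transform, with the sign and scaling for which a shift of s by i u turns
  e^(-l s) into the oscillation at frequency l.\<close>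

definition transform :: "(real \<Rightarrow> real) \<Rightarrow> real \<Rightarrow> complex" where
  "transform K \<xi> = (LINT u|lborel. of_real (K u) * exp (- \<i> * of_real \<xi> * of_real u))"

lemma integrable_transform:
  assumes "integrable lborel K"
  shows "integrable lborel (\<lambda>u. of_real (K u) * exp (- \<i> * of_real \<xi> * of_real u) :: complex)"
proof (rule Bochner_Integration.integrable_bound[OF assms])
  have [measurable]: "K \<in> borel_measurable borel"
    using assms by auto
  show "(\<lambda>u. of_real (K u) * exp (- \<i> * of_real \<xi> * of_real u) :: complex) \<in> borel_measurable lborel"
    by (auto intro!: borel_measurable_times borel_measurable_continuous_onI continuous_intros)
qed (auto simp: norm_mult norm_exp_eq_Re)

lemma transform_minus:
  assumes "\<And>u. K (- u) = K u"
  shows "transform K (- \<xi>) = transform K \<xi>"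
  unfolding transform_def
  by (subst lborel_integral_real_affine[where c = "-1" and t = 0]) (auto simp: assms)

text \<open>In the upper half plane |cos z| <= e^(Im z). This exponential type 1 is why the M-th
  power has its transform supported in [-M, M].\<close>

lemma norm_cfejer_le:
  assumes "0 \<le> Im z" "1 \<le> norm z"
  shows "norm (cfejer z) \<le> 2 * exp (Im z) / (norm z)\<^sup>2"
proof -
  have "norm (1 - cos z) \<le> 1 + norm (cos z)"
    by (rule order_trans[OF norm_triangle_ineq4]) simp
  also have "norm (cos z) \<le> (norm (exp (\<i> * z)) + norm (exp (- (\<i> * z)))) / 2"
    unfolding cos_exp_eq norm_divide by (simp add: divide_right_mono norm_triangle_ineq del: norm_exp_eq_Re)
  also have "\<dots> \<le> exp (Im z)"
    using assms by (simp add: norm_exp_eq_Re)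
  also have "1 + exp (Im z) \<le> 2 * exp (Im z)"
    using assms by simp
  finally show ?thesis
    using assms by (auto simp: cfejer_def norm_divide norm_power divide_right_mono)
qed

text \<open>For \<open>\<xi> \<le> - M\<close> the integrand is \<open>O(\<bar>z\<bar>\<^sup>-\<^sup>2)\<close> in the upper half plane, so the
  integral is computed by closing the contour there.\<close>

lemma transform_fejer_power_eq_0:
  assumes M: "0 < M" and \<xi>: "real M \<le> \<bar>\<xi>\<bar>"
  shows "transform (\<lambda>u. fejer u ^ M) \<xi> = 0"
proof -
  \<comment> \<open>The kernel is even, so frequencies at or below -M suffice.\<close>
  have neg: "transform (\<lambda>u. fejer u ^ M) \<xi> = 0" if \<xi>: "\<xi> \<le> - real M" for \<xi>
  proof -
    define g where "g z = cfejer z ^ M * exp (- \<i> * of_real \<xi> * z)" for z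
    have hol: "g holomorphic_on UNIV"
      unfolding g_def using cfejer_holomorphic by (intro holomorphic_intros) auto
    have bound: "norm (g z) \<le> 2 ^ M / (norm z)\<^sup>2" if z: "0 \<le> Im z" "1 \<le> norm z" for z
    proof -
      have "norm (g z) \<le> (2 * exp (Im z) / (norm z)\<^sup>2) ^ M * exp (\<xi> * Im z)"
        unfolding g_def norm_mult norm_power
        by (intro mult_mono power_mono norm_cfejer_le z) (auto simp: norm_exp_eq_Re)
      also have "\<dots> = 2 ^ M * exp ((real M + \<xi>) * Im z) / ((norm z)\<^sup>2) ^ M"
        by (simp add: power_divide power_mult_distrib exp_of_nat_mult[symmetric] exp_add[symmetric] algebra_simps)
      \<comment> \<open>M + xi <= 0 makes the exponential at most 1, and |z| >= 1 allows the
        exponent M to drop to 1.\<close>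
      also have "\<dots> \<le> 2 ^ M * 1 / ((norm z)\<^sup>2) ^ 1"
        using z M \<xi> by (intro frac_le mult_left_mono power_increasing) (auto intro: mult_nonpos_nonneg)
      finally show ?thesis
        by simp
    qed
    have est: "norm (integral {-R..R} (\<lambda>u. g (of_real u))) \<le> 2 ^ M * pi / R" if R: "1 \<le> R" for R
    proof -
      let ?a = "linepath (of_real (- R)) (of_real R :: complex)" and ?b = "part_circlepath 0 R 0 pi"
      have ends: "pathstart ?b = of_real R" "pathfinish ?b = of_real (- R)"
        by auto
      have "(g has_contour_integral 0) (?a +++ ?b)"
        by (rule Cauchy_theorem_convex_simple[OF hol]) (auto intro!: valid_path_join simp: ends)
      moreover have cont: "g contour_integrable_on ?a" "g contour_integrable_on ?b"
        using holomorphic_on_imp_continuous_on[OF hol]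
        by (auto intro!: contour_integrable_continuous_linepath contour_integrable_continuous_part_circlepath
            intro: continuous_on_subset)
      ultimately have eq: "contour_integral ?a g = - contour_integral ?b g"
        by (metis contour_integral_join contour_integral_unique ends(1) pathfinish_linepath
            valid_path_linepath valid_path_part_circlepath eq_neg_iff_add_eq_0)
      have "(g has_contour_integral (contour_integral ?a g)) ?a"
        using cont(1) by (rule has_contour_integral_integral)
      then have "contour_integral ?a g = integral {-R..R} (\<lambda>u. g (of_real u))"
        using R by (subst (asm) has_contour_integral_linepath_Reals_iff) (auto simp: integral_unique)
      moreover have "norm (contour_integral ?b g) \<le> 2 ^ M / R\<^sup>2 * R * \<bar>pi - 0\<bar>"
      proof (rule contour_integral_bound_part_circlepath[OF cont(2)])
        fix z assume "z \<in> path_image ?b"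
        then obtain t where t: "0 \<le> t" "t \<le> pi" "z = of_real R * exp (\<i> * of_real t)"
          by (auto simp: path_image_part_circlepath' closed_segment_eq_real_ivl cis_conv_exp)
        have "norm z = R"
          using R by (simp add: t norm_mult)
        moreover have "0 \<le> Im z"
          using R t sin_ge_zero[of t] by (simp add: t(3) Im_exp)
        ultimately show "norm (g z) \<le> 2 ^ M / R\<^sup>2"
          using bound R by metis
      qed (use R in auto)
      ultimately show ?thesis
        using R eq by (simp add: power2_eq_square)
    qed
    have "((\<lambda>R. integral {-R..R} (\<lambda>u. g (of_real u))) \<longlongrightarrow> 0) at_top"
    proof (rule Lim_null_comparison)
      show "\<forall>\<^sub>F R in at_top. norm (integral {- R..R} (\<lambda>u. g (of_real u))) \<le> 2 ^ M * pi / R"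
        using eventually_ge_at_top[of 1] by eventually_elim (rule est)
      show "((\<lambda>R. 2 ^ M * pi / R) \<longlongrightarrow> 0) at_top"
        by (intro tendsto_divide_0[OF tendsto_const] filterlim_at_top_imp_at_infinity filterlim_ident)
    qed
    moreover have "((\<lambda>R. integral {-R..R} (\<lambda>u. g (of_real u))) \<longlongrightarrow> transform (\<lambda>u. fejer u ^ M) \<xi>) at_top"
      using integral_symmetric_tendsto[OF integrable_transform[OF integrable_fejer_power[OF M], of \<xi>]]
      by (simp add: transform_def g_def cfejer_of_real)
    ultimately show ?thesis
      by (metis tendsto_unique trivial_limit_at_top_linorder)
  qed
  show ?thesis
    using neg[of \<xi>] neg[of "- \<xi>"] \<xi> transform_minus[of "\<lambda>u. fejer u ^ M" \<xi>] by (cases "\<xi> \<ge> 0") auto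
qed

text \<open>A nonnegative function with integral 0 vanishes almost everywhere, but 1 - cos u > 0 on
  the whole interval (0, pi).\<close>

lemma integral_fejer_power_pos:
  assumes "0 < M"
  shows "0 < (LINT u|lborel. fejer u ^ M)"
proof -
  have "(LINT u|lborel. fejer u ^ M) \<noteq> 0"
  proof
    assume "(LINT u|lborel. fejer u ^ M) = 0"
    then have "AE u in lborel. fejer u ^ M = 0"
      using integral_nonneg_eq_0_iff_AE[OF integrable_fejer_power[OF assms]] by (simp add: fejer_nonneg)
    then have "AE u in lborel. u \<notin> {0<..<pi}"
    proof eventually_elim
      case (elim u)
      then have "cos u = 1 \<and> u \<noteq> 0"
        by (auto simp: fejer_def split: if_splits)
      then show ?case
        using cos_monotone_0_pi[of 0 u] by auto
    qed
    then have "{0<..<pi} \<in> null_sets lborel"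
      by (subst AE_iff_null_sets) auto
    then show False
      by (auto simp: null_sets_def)
  qed
  then show ?thesis
    using integral_nonneg_AE[of "\<lambda>u. fejer u ^ M" lborel] by (simp add: fejer_nonneg less_le)
qed

text \<open>By evenness this is a cosine integral, and product-to-sum turns (1 - cos u) cos(xi u) /
  u^2 into a second difference of dilates. Since a^2 fejer(a u) has |a| times the integral of
  \<open>fejer\<close>, the triangle arises as a second difference of |xi|, and the total integral
  never has to be evaluated.\<close>

lemma transform_fejer:
  "transform fejer \<xi> = of_real ((LINT u|lborel. fejer u) * max 0 (1 - \<bar>\<xi>\<bar>))"
proof -
  let ?c = "LINT u|lborel. fejer u"
  have int: "integrable lborel fejer"
    using integrable_fejer_power[of 1] by simp
  have scale: "integrable lborel (\<lambda>u. a\<^sup>2 * fejer (a * u))" "(LINT u|lborel. a\<^sup>2 * fejer (a * u)) = ?c * \<bar>a\<bar>" for a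
  proof -
    show "integrable lborel (\<lambda>u. a\<^sup>2 * fejer (a * u))"
      using lborel_integrable_real_affine[OF int, of a 0] by (cases "a = 0") auto
    have "?c = \<bar>a\<bar> * (LINT u|lborel. fejer (a * u))" if "a \<noteq> 0"
      using lborel_integral_real_affine[OF that, of fejer 0] by simp
    moreover have "a\<^sup>2 = \<bar>a\<bar> * \<bar>a\<bar>"
      by (simp add: power2_eq_square)
    ultimately show "(LINT u|lborel. a\<^sup>2 * fejer (a * u)) = ?c * \<bar>a\<bar>"
      by (cases "a = 0") auto
  qed
  have cos_form: "fejer u * cos (\<xi> * u) = (1 + \<xi>)\<^sup>2 * fejer ((1 + \<xi>) * u) / 2
      + (1 - \<xi>)\<^sup>2 * fejer ((1 - \<xi>) * u) / 2 - \<xi>\<^sup>2 * fejer (\<xi> * u)" for u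
  proof (cases "u = 0")
    case False
    have *: "a\<^sup>2 * fejer (a * u) = (1 - cos (a * u)) / u\<^sup>2" for a
      using False by (auto simp: fejer_def power_mult_distrib)
    show ?thesis
      unfolding * using False
      by (simp add: fejer_def cos_add cos_diff field_simps)
  qed (simp add: fejer_def power2_eq_square field_simps)
  define h where "h a u = a\<^sup>2 * fejer (a * u)" for a u
  have "(LINT u|lborel. fejer u * cos (\<xi> * u)) = ?c * (\<bar>1 + \<xi>\<bar> / 2 + \<bar>1 - \<xi>\<bar> / 2 - \<bar>\<xi>\<bar>)"
    using scale[folded h_def] unfolding cos_form h_def[symmetric] by (simp add: algebra_simps)
  also have "\<bar>1 + \<xi>\<bar> / 2 + \<bar>1 - \<xi>\<bar> / 2 - \<bar>\<xi>\<bar> = max 0 (1 - \<bar>\<xi>\<bar>)"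
    by (auto simp: abs_if max_def field_simps)
  finally have re: "(LINT u|lborel. fejer u * cos (\<xi> * u)) = ?c * max 0 (1 - \<bar>\<xi>\<bar>)" .
  have "transform fejer \<xi> = (transform fejer \<xi> + transform fejer (- \<xi>)) / 2"
    using transform_minus[of fejer \<xi>] by simp
  also have "\<dots> = (LINT u|lborel. (of_real (fejer u) * exp (- \<i> * of_real \<xi> * of_real u)
      + of_real (fejer u) * exp (- \<i> * of_real (- \<xi>) * of_real u)) / 2)"
    unfolding transform_def using integrable_transform[OF int, of \<xi>] integrable_transform[OF int, of "- \<xi>"] by simp
  also have "\<dots> = (LINT u|lborel. of_real (fejer u * cos (\<xi> * u)))"
    by (intro Bochner_Integration.integral_cong refl) (simp add: cos_of_real[symmetric] cos_exp_eq algebra_simps)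
  also have "\<dots> = of_real (?c * max 0 (1 - \<bar>\<xi>\<bar>))"
    unfolding re[symmetric] by (rule integral_complex_of_real)
  finally show ?thesis .
qed

definition fejer_kernel :: "nat \<Rightarrow> real \<Rightarrow> real" where
  "fejer_kernel M u = fejer u ^ M / (LINT u|lborel. fejer u ^ M)"

lemma fejer_kernel:
  assumes "0 < M"
  shows "integrable lborel (fejer_kernel M)" "0 \<le> fejer_kernel M u" "(LINT u|lborel. fejer_kernel M u) = 1"
  using integrable_fejer_power[OF assms] integral_fejer_power_pos[OF assms]
  by (auto simp: fejer_kernel_def[abs_def] fejer_nonneg)

lemma transform_fejer_kernel:
  "transform (fejer_kernel M) \<xi> = transform (\<lambda>u. fejer u ^ M) \<xi> / of_real (LINT u|lborel. fejer u ^ M)"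
  unfolding transform_def fejer_kernel_def of_real_divide times_divide_eq_left integral_divide_zero ..

text \<open>At xi = l / X with 0 <= l < X this is 1 - l / X, the Riesz factor of order 1.\<close>

lemma transform_fejer_kernel_1: "transform (fejer_kernel 1) \<xi> = of_real (max 0 (1 - \<bar>\<xi>\<bar>))"
  using integral_fejer_power_pos[of 1] by (simp add: transform_fejer_kernel transform_fejer)

subsection \<open>Bohr means and uniformly almost periodic functions\<close>

definition average :: "real \<Rightarrow> (real \<Rightarrow> complex) \<Rightarrow> complex" where
  "average T F = of_real (1 / (2 * T)) * integral {-T..T} F"

text \<open>Convergence is part of the notion: \<open>bohr_coeff\<close> uses \<open>Lim\<close>,
  which says nothing until the limit is known to exist.\<close>

definition has_mean :: "(real \<Rightarrow> complex) \<Rightarrow> complex \<Rightarrow> bool" where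
  "has_mean F c \<longleftrightarrow> ((\<lambda>T. average T F) \<longlongrightarrow> c) at_top"

lemma integrable_on_continuous_UNIV:
  fixes F :: "real \<Rightarrow> complex"
  shows "continuous_on UNIV F \<Longrightarrow> F integrable_on {a..b}"
  by (rule integrable_continuous_interval) (auto intro: continuous_on_subset)

lemma has_mean_cmult: "has_mean F c \<Longrightarrow> has_mean (\<lambda>t. a * F t) (a * c)"
  using tendsto_mult_left[of "\<lambda>T. average T F" c at_top a]
  by (simp add: has_mean_def average_def mult.left_commute)

lemma has_mean_diff:
  assumes "has_mean F c" "has_mean G d" "continuous_on UNIV F" "continuous_on UNIV G"
  shows "has_mean (\<lambda>t. F t - G t) (c - d)"
proof -
  have "average T (\<lambda>t. F t - G t) = average T F - average T G" for T
    unfolding average_def using assms(3,4)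
    by (subst Henstock_Kurzweil_Integration.integral_diff) (auto simp: integrable_on_continuous_UNIV right_diff_distrib)
  then show ?thesis
    using tendsto_diff[OF assms(1,2)[unfolded has_mean_def]] by (simp add: has_mean_def)
qed

lemma has_mean_sum:
  assumes "finite A" "\<And>\<alpha>. \<alpha> \<in> A \<Longrightarrow> has_mean (F \<alpha>) (c \<alpha>)" "\<And>\<alpha>. \<alpha> \<in> A \<Longrightarrow> continuous_on UNIV (F \<alpha>)"
  shows "has_mean (\<lambda>t. \<Sum>\<alpha>\<in>A. F \<alpha> t) (\<Sum>\<alpha>\<in>A. c \<alpha>)"
proof -
  have "average T (\<lambda>t. \<Sum>\<alpha>\<in>A. F \<alpha> t) = (\<Sum>\<alpha>\<in>A. average T (F \<alpha>))" for T
    unfolding average_def using assms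
    by (subst integral_sum) (auto simp: sum_distrib_left integrable_on_continuous_UNIV)
  then show ?thesis
    using assms unfolding has_mean_def by (auto intro: tendsto_sum)
qed

lemma has_mean_exp: "has_mean (\<lambda>t. exp (\<i> * of_real \<alpha> * of_real t)) (if \<alpha> = 0 then 1 else 0)"
proof (cases "\<alpha> = 0")
  case True
  have "\<forall>\<^sub>F T in at_top. average T (\<lambda>t. exp (\<i> * of_real \<alpha> * of_real t)) = 1"
    using eventually_gt_at_top[of 0] by eventually_elim (simp add: average_def True scaleR_conv_of_real)
  then show ?thesis
    by (simp add: has_mean_def True tendsto_eventually)
next
  case False
  have "norm (average T (\<lambda>t. exp (\<i> * of_real \<alpha> * of_real t))) \<le> 1 / \<bar>\<alpha>\<bar> / T" if "0 < T" for T
  proof -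
    have "((\<lambda>t. exp (\<i> * of_real \<alpha> * of_real t)) has_integral
        exp (\<i> * of_real \<alpha> * of_real T) / (\<i> * of_real \<alpha>) - exp (\<i> * of_real \<alpha> * of_real (- T)) / (\<i> * of_real \<alpha>)) {-T..T}"
    proof (rule fundamental_theorem_of_calculus)
      fix t :: real
      have "((\<lambda>z. exp (\<i> * of_real \<alpha> * z) / (\<i> * of_real \<alpha>)) has_field_derivative exp (\<i> * of_real \<alpha> * of_real t)) (at (of_real t))"
        using False by (auto intro!: derivative_eq_intros)
      then show "((\<lambda>t. exp (\<i> * of_real \<alpha> * of_real t) / (\<i> * of_real \<alpha>)) has_vector_derivative
          exp (\<i> * of_real \<alpha> * of_real t)) (at t within {-T..T})"
        by (rule has_vector_derivative_real_field)
    qed (use that in simp)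
    then have "norm (integral {-T..T} (\<lambda>t. exp (\<i> * of_real \<alpha> * of_real t))) \<le> 1 / \<bar>\<alpha>\<bar> + 1 / \<bar>\<alpha>\<bar>"
      by (simp only: integral_unique) (intro order_trans[OF norm_triangle_ineq4] add_mono, auto simp: norm_divide norm_mult norm_exp_eq_Re)
    then show ?thesis
      using that by (simp add: average_def norm_mult norm_divide field_simps)
  qed
  then have "\<forall>\<^sub>F T in at_top. norm (average T (\<lambda>t. exp (\<i> * of_real \<alpha> * of_real t))) \<le> 1 / \<bar>\<alpha>\<bar> / T"
    using eventually_gt_at_top[of 0] by (rule eventually_mono[rotated])
  moreover have "((\<lambda>T. 1 / \<bar>\<alpha>\<bar> / T) \<longlongrightarrow> 0) at_top"
    by (intro tendsto_divide_0[OF tendsto_const] filterlim_at_top_imp_at_infinity filterlim_ident)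
  ultimately show ?thesis
    using False unfolding has_mean_def by (auto intro: Lim_null_comparison)
qed

lemma norm_average_diff_le:
  assumes "continuous_on UNIV F" "continuous_on UNIV G" "\<And>t. norm (F t - G t) \<le> e" "0 < T"
  shows "norm (average T F - average T G) \<le> e"
proof -
  have "norm (integral {-T..T} (\<lambda>t. F t - G t)) \<le> e * (T - (- T))"
    using assms by (intro integral_bound) (auto intro!: continuous_intros intro: continuous_on_subset)
  moreover have "average T F - average T G = of_real (1 / (2 * T)) * integral {-T..T} (\<lambda>t. F t - G t)"
    unfolding average_def using assms
    by (subst Henstock_Kurzweil_Integration.integral_diff) (auto simp: integrable_on_continuous_UNIV right_diff_distrib)
  ultimately have "norm (average T F - average T G) \<le> 1 / (2 * T) * (e * (T - (- T)))"
    using assms(4) by (simp only: norm_mult norm_of_real) (intro mult_mono, auto)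
  then show ?thesis
    using assms(4) by simp
qed

text \<open>Each finite average contracts the supremum norm, and the limit inherits this.\<close>

lemma norm_mean_diff_le:
  assumes "has_mean F c" "has_mean G d" "continuous_on UNIV F" "continuous_on UNIV G"
    and "\<And>t. norm (F t - G t) \<le> e"
  shows "norm (c - d) \<le> e"
proof (rule tendsto_upperbound)
  show "((\<lambda>T. norm (average T F - average T G)) \<longlongrightarrow> norm (c - d)) at_top"
    using assms unfolding has_mean_def by (intro tendsto_intros)
  show "\<forall>\<^sub>F T in at_top. norm (average T F - average T G) \<le> e"
    using eventually_gt_at_top[of 0] by eventually_elim (use assms norm_average_diff_le in blast)
qed auto

text \<open>Means pass to uniform limits. The value c is given in advance, and the means d of the
  approximants only have to come near it.\<close>

lemma has_mean_approx:
  assumes F: "continuous_on UNIV F"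
    and approx: "\<And>e. 0 < e \<Longrightarrow> \<exists>G d. continuous_on UNIV G \<and> has_mean G d \<and> (\<forall>t. norm (F t - G t) \<le> e) \<and> norm (c - d) \<le> e"
  shows "has_mean F c"
  unfolding has_mean_def
proof (rule tendstoI)
  fix e :: real assume "0 < e"
  then obtain G d where G: "continuous_on UNIV G" "has_mean G d" "\<And>t. norm (F t - G t) \<le> e / 3" "norm (c - d) \<le> e / 3"
    using approx[of "e / 3"] by auto
  have "\<forall>\<^sub>F T in at_top. dist (average T G) d < e / 3"
    using G(2) \<open>0 < e\<close> unfolding has_mean_def by (intro tendstoD) auto
  then show "\<forall>\<^sub>F T in at_top. dist (average T F) c < e"
    using eventually_gt_at_top[of 0]
  proof eventually_elim
    case (elim T)
    have "norm (average T F - average T G) \<le> e / 3"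
      using F G elim by (intro norm_average_diff_le) auto
    then show ?case
      using elim(1) G(4) by norm
  qed
qed

section \<open>Trigonometric polynomials and uniform almost periodicity\<close>

lemma trig_polynomialI: "finite A \<Longrightarrow> trig_polynomial (\<lambda>t. \<Sum>\<alpha>\<in>A. c \<alpha> * exp (- \<i> * of_real \<alpha> * of_real t))"
  unfolding trig_polynomial_def by blast

lemma trig_polynomial_continuous: "trig_polynomial p \<Longrightarrow> continuous_on UNIV p"
  unfolding trig_polynomial_def by (auto intro!: continuous_intros)

lemma trig_polynomial_add:
  assumes "trig_polynomial p" "trig_polynomial q"
  shows "trig_polynomial (\<lambda>t. p t + q t)"
proof -
  obtain A c B d where *: "finite A" "p = (\<lambda>t. \<Sum>\<alpha>\<in>A. c \<alpha> * exp (- \<i> * of_real \<alpha> * of_real t))"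
    "finite B" "q = (\<lambda>t. \<Sum>\<alpha>\<in>B. d \<alpha> * exp (- \<i> * of_real \<alpha> * of_real t))"
    using assms unfolding trig_polynomial_def by blast
  then have "(\<lambda>t. p t + q t) = (\<lambda>t. \<Sum>\<alpha>\<in>A \<union> B.
      ((if \<alpha> \<in> A then c \<alpha> else 0) + (if \<alpha> \<in> B then d \<alpha> else 0)) * exp (- \<i> * of_real \<alpha> * of_real t))"
    unfolding distrib_right sum.distrib *(2,4)
    by (intro ext arg_cong2[where f = "(+)"] sum.mono_neutral_cong_left) auto
  then show ?thesis
    using trig_polynomialI[of "A \<union> B"] *(1,3) by (simp only: finite_Un)
qed

lemma uniformly_almost_periodic_iff:
  "uniformly_almost_periodic F \<longleftrightarrow> (\<forall>e>0. \<exists>p. trig_polynomial p \<and> (\<forall>t. norm (F t - p t) \<le> e))"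
proof
  assume "uniformly_almost_periodic F"
  then obtain p where p: "\<And>n::nat. trig_polynomial (p n)" "uniform_limit UNIV p F sequentially"
    unfolding uniformly_almost_periodic_def by auto
  show "\<forall>e>0. \<exists>p. trig_polynomial p \<and> (\<forall>t. norm (F t - p t) \<le> e)"
  proof (intro allI impI)
    fix e :: real assume "0 < e"
    then obtain n where "\<forall>t. dist (p n t) (F t) < e"
      using uniform_limitD[OF p(2), of e] by (auto simp: eventually_sequentially)
    then show "\<exists>p. trig_polynomial p \<and> (\<forall>t. norm (F t - p t) \<le> e)"
      using p(1) by (metis dist_commute dist_norm less_imp_le)
  qed
next
  assume "\<forall>e>0. \<exists>p. trig_polynomial p \<and> (\<forall>t. norm (F t - p t) \<le> e)"
  then have "\<forall>n::nat. \<exists>p. trig_polynomial p \<and> (\<forall>t. norm (F t - p t) \<le> inverse (real (Suc n)))"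
    by simp
  from choice[OF this]
  obtain p where p: "\<And>n::nat. trig_polynomial (p n)" "\<And>n t. norm (F t - p n t) \<le> inverse (real (Suc n))"
    by blast
  have "uniform_limit UNIV p F sequentially"
  proof (rule uniform_limitI)
    fix e :: real assume "0 < e"
    then have "\<forall>\<^sub>F n in sequentially. inverse (real (Suc n)) < e"
      using LIMSEQ_inverse_real_of_nat by (rule order_tendstoD(2)[rotated])
    then show "\<forall>\<^sub>F n in sequentially. \<forall>t\<in>UNIV. dist (p n t) (F t) < e"
      by eventually_elim (metis dist_commute dist_norm le_less_trans p(2))
  qed
  with p(1) show "uniformly_almost_periodic F"
    unfolding uniformly_almost_periodic_def by auto
qed

lemma uniformly_almost_periodicE:
  assumes "uniformly_almost_periodic F" "0 < e"
  obtains A c where "finite A" "\<And>t. norm (F t - (\<Sum>\<alpha>\<in>A. c \<alpha> * exp (- \<i> * of_real \<alpha> * of_real t))) \<le> e"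
  using assms unfolding uniformly_almost_periodic_iff trig_polynomial_def by metis

lemma uniformly_almost_periodic_continuous:
  assumes "uniformly_almost_periodic F"
  shows "continuous_on UNIV F"
  using assms unfolding uniformly_almost_periodic_def
  by (auto intro!: uniform_limit_theorem[where F = sequentially] simp: trig_polynomial_continuous)

lemma uniformly_almost_periodic_bounded:
  assumes "uniformly_almost_periodic F"
  obtains B where "0 < B" "\<And>t. norm (F t) \<le> B"
proof -
  obtain A c where A: "finite A" "\<And>t. norm (F t - (\<Sum>\<alpha>\<in>A. c \<alpha> * exp (- \<i> * of_real \<alpha> * of_real t))) \<le> 1"
    using assms uniformly_almost_periodicE[of F 1] by auto
  have "norm (F t) \<le> 1 + (\<Sum>\<alpha>\<in>A. norm (c \<alpha>))" for t
  proof -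
    have "norm (\<Sum>\<alpha>\<in>A. c \<alpha> * exp (- \<i> * of_real \<alpha> * of_real t)) \<le> (\<Sum>\<alpha>\<in>A. norm (c \<alpha>))"
      by (rule sum_norm_le) (simp add: norm_mult norm_exp_eq_Re)
    then show ?thesis
      using A(2)[of t] by norm
  qed
  moreover have "0 < 1 + (\<Sum>\<alpha>\<in>A. norm (c \<alpha>))"
    by (simp add: add_pos_nonneg sum_nonneg)
  ultimately show ?thesis
    using that by blast
qed

lemma has_mean_trig_polynomial_mult_exp:
  assumes "finite A"
  shows "has_mean (\<lambda>t. (\<Sum>\<alpha>\<in>A. c \<alpha> * exp (- \<i> * of_real \<alpha> * of_real t)) * exp (\<i> * of_real y * of_real t))
    (if y \<in> A then c y else 0)"
proof -
  have exp_eq: "c \<alpha> * exp (- \<i> * of_real \<alpha> * of_real t) * exp (\<i> * of_real y * of_real t)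
      = c \<alpha> * exp (\<i> * of_real (y - \<alpha>) * of_real t)" for \<alpha> t :: real
    unfolding mult.assoc exp_add[symmetric] by (simp add: algebra_simps)
  have sum_eq: "(\<Sum>\<alpha>\<in>A. c \<alpha> * (if y - \<alpha> = 0 then 1 else 0)) = (if y \<in> A then c y else 0)"
  proof -
    have "c \<alpha> * (if y - \<alpha> = 0 then 1 else 0) = (if \<alpha> = y then c \<alpha> else 0)" for \<alpha>
      by simp
    then show ?thesis
      using assms by (simp only: sum.delta)
  qed
  show ?thesis
    unfolding sum_distrib_right exp_eq sum_eq[symmetric]
    by (intro has_mean_sum has_mean_cmult has_mean_exp assms) (auto intro!: continuous_intros)
qed

text \<open>The factor of modulus 1 preserves uniform distances and means contract them, so the
  means of approximating trigonometric polynomials form a Cauchy sequence; its limit is the mean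
  sought.\<close>

lemma uniformly_almost_periodic_has_mean:
  assumes F: "uniformly_almost_periodic F"
  shows "\<exists>c. has_mean (\<lambda>t. F t * exp (\<i> * of_real y * of_real t)) c"
proof -
  have "\<forall>n::nat. \<exists>p. trig_polynomial p \<and> (\<forall>t. norm (F t - p t) \<le> inverse (real (Suc n)))"
    using F[unfolded uniformly_almost_periodic_iff] by (intro allI) (erule allE, erule mp, simp)
  from choice[OF this]
  obtain p where "\<forall>n::nat. trig_polynomial (p n) \<and> (\<forall>t. norm (F t - p n t) \<le> inverse (real (Suc n)))" ..
  then have p: "\<And>n::nat. trig_polynomial (p n)" "\<And>n t. norm (F t - p n t) \<le> inverse (real (Suc n))"
    by auto
  let ?E = "\<lambda>t. exp (\<i> * of_real y * of_real t)"
  have cont: "continuous_on UNIV (\<lambda>t. F t * ?E t)" "continuous_on UNIV (\<lambda>t. p n t * ?E t)" for n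
    by (intro continuous_intros uniformly_almost_periodic_continuous[OF F] trig_polynomial_continuous[OF p(1)])+
  have "\<exists>c. has_mean (\<lambda>t. p n t * ?E t) c" for n
  proof -
    obtain A c where "finite A" "p n = (\<lambda>t. \<Sum>\<alpha>\<in>A. c \<alpha> * exp (- \<i> * of_real \<alpha> * of_real t))"
      using p(1)[of n] unfolding trig_polynomial_def by blast
    then show ?thesis
      using has_mean_trig_polynomial_mult_exp[of A c y] by auto
  qed
  then obtain c where c: "\<And>n. has_mean (\<lambda>t. p n t * ?E t) (c n)"
    by metis
  have diff: "norm (F t * ?E t - p n t * ?E t) \<le> inverse (real (Suc n))" for n t
    using p(2)[of t n] by (simp add: left_diff_distrib[symmetric] norm_mult norm_exp_eq_Re)
  have "norm (c m - c n) \<le> inverse (real (Suc m)) + inverse (real (Suc n))" for m n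
  proof (rule norm_mean_diff_le[OF c c cont(2) cont(2)])
    fix t
    show "norm (p m t * ?E t - p n t * ?E t) \<le> inverse (real (Suc m)) + inverse (real (Suc n))"
      using norm_triangle_le_diff[of "F t * ?E t - p n t * ?E t" "F t * ?E t - p m t * ?E t"]
        diff[of t m] diff[of t n] by simp
  qed
  then have "norm (c m - c n) \<le> 2 * inverse (real (Suc N))" if "N \<le> m" "N \<le> n" for m n N
    using that by (smt (verit) le_imp_inverse_le of_nat_0_less_iff of_nat_mono Suc_le_mono zero_less_Suc)
  note c_diff = this
  have "Cauchy c"
  proof (rule CauchyI)
    fix e :: real assume "0 < e"
    then obtain N where "inverse (real (Suc N)) < e / 2"
      using reals_Archimedean[of "e / 2"] by auto
    then show "\<exists>M. \<forall>m\<ge>M. \<forall>n\<ge>M. norm (c m - c n) < e"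
      by (intro exI[of _ N] allI impI) (rule le_less_trans[OF c_diff[of N]], auto)
  qed
  then obtain d where d: "c \<longlonglongrightarrow> d"
    using Cauchy_convergent convergent_def by blast
  have "has_mean (\<lambda>t. F t * ?E t) d"
  proof (rule has_mean_approx[OF cont(1)])
    fix e :: real assume "0 < e"
    have "\<forall>\<^sub>F n in sequentially. inverse (real (Suc n)) < e"
      using LIMSEQ_inverse_real_of_nat \<open>0 < e\<close> by (rule order_tendstoD(2))
    moreover have "\<forall>\<^sub>F n in sequentially. dist (c n) d < e"
      using d \<open>0 < e\<close> by (rule tendstoD)
    ultimately obtain n where n: "inverse (real (Suc n)) < e" "dist (c n) d < e"
      using eventually_happens'[OF sequentially_bot eventually_conj] by blast
    then show "\<exists>G d'. continuous_on UNIV G \<and> has_mean G d' \<and> (\<forall>t. norm (F t * ?E t - G t) \<le> e) \<and> norm (d - d') \<le> e"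
      using c cont(2) order_trans[OF diff less_imp_le[OF n(1)]] n(2)
      by (intro exI[of _ "\<lambda>t. p n t * ?E t"] exI[of _ "c n"] conjI allI) (auto simp: dist_norm norm_minus_commute)
  qed
  then show ?thesis ..
qed

text \<open>The factor e^(\<open>\<sigma>\<close> x) does not depend on t and comes out of the
  average. Once the mean exists, \<open>Lim\<close> picks it.\<close>

lemma bohr_coeff_eq:
  assumes "has_mean (\<lambda>t. f (Complex \<sigma> t) * exp (\<i> * of_real x * of_real t)) c"
  shows "bohr_coeff f \<sigma> x = exp (of_real (\<sigma> * x)) * c"
proof -
  have "f (Complex \<sigma> t) * exp (Complex \<sigma> t * of_real x)
      = exp (of_real (\<sigma> * x)) * (f (Complex \<sigma> t) * exp (\<i> * of_real x * of_real t))" for t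
    by (simp add: Complex_eq exp_add[symmetric] algebra_simps)
  then show ?thesis
    using has_mean_cmult[OF assms, of "exp (of_real (\<sigma> * x))"]
    unfolding bohr_coeff_def has_mean_def average_def by (intro tendsto_Lim) (simp_all only: trivial_limit_at_top_linorder not_False_eq_True)
qed

section \<open>Translates and the uniqueness theorem\<close>

text \<open>Pigeonhole: cover the unit circle by finitely many balls of radius e / 2 and record, for
  each h, which ball holds each of the exponentials. Only finitely many records occur, and one h'
  per record suffices.\<close>

lemma exp_translates_totally_bounded:
  fixes A :: "real set"
  assumes "finite A" "0 < e"
  obtains H :: "real set" where "finite H"
    "\<And>h. \<exists>h'\<in>H. \<forall>\<alpha>\<in>A. norm (exp (- \<i> * of_real \<alpha> * of_real h) - exp (- \<i> * of_real \<alpha> * of_real h')) < e"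
proof -
  obtain K where K: "finite K" "sphere (0::complex) 1 \<subseteq> (\<Union>k\<in>K. ball k (e / 2))"
    using compact_eq_totally_bounded[of "sphere (0::complex) 1"] assms(2) by (metis compact_sphere half_gt_zero)
  have "\<exists>k\<in>K. exp (- \<i> * of_real \<alpha> * of_real h) \<in> ball k (e / 2)" for \<alpha> h :: real
    using K(2) by (auto simp: norm_exp_eq_Re subset_iff)
  then obtain k where k: "\<And>\<alpha> h. k \<alpha> h \<in> K" "\<And>\<alpha> h. exp (- \<i> * of_real \<alpha> * of_real h) \<in> ball (k \<alpha> h) (e / 2)"
    by metis
  \<comment> \<open>\<open>restrict\<close> makes each record an extensional function on A, so that
    the records lie in a finite set.\<close>
  define g where "g h = restrict (\<lambda>\<alpha>. k \<alpha> h) A" for h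
  have "range g \<subseteq> A \<rightarrow>\<^sub>E K"
    using k(1) by (auto simp: g_def)
  then have "finite (range g)"
    using finite_PiE[OF assms(1), of "\<lambda>_. K"] K(1) finite_subset by blast
  then obtain H where H: "finite H" "range g = g ` H"
    using finite_subset_image[of "range g" g UNIV] by auto
  have "\<exists>h'\<in>H. \<forall>\<alpha>\<in>A. norm (exp (- \<i> * of_real \<alpha> * of_real h) - exp (- \<i> * of_real \<alpha> * of_real h')) < e" for h
  proof -
    obtain h' where h': "h' \<in> H" "g h = g h'"
      using H(2) by (metis imageE rangeI)
    then have "k \<alpha> h = k \<alpha> h'" if "\<alpha> \<in> A" for \<alpha>
      using that by (metis g_def restrict_apply')
    then have "norm (exp (- \<i> * of_real \<alpha> * of_real h) - exp (- \<i> * of_real \<alpha> * of_real h')) < e" if "\<alpha> \<in> A" for \<alpha>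
      using k(2)[of \<alpha> h] k(2)[of \<alpha> h'] that
      by (metis dist_commute dist_norm dist_triangle_half_l mem_ball)
    then show ?thesis
      using h'(1) by blast
  qed
  with H(1) show ?thesis
    using that by blast
qed

text \<open>One direction of Bochner's characterization. A trigonometric polynomial within e / 4 of
  F reduces it to finitely many exponentials; two approximation errors and a translation error of e
  / 4 stay below e.\<close>

lemma uniformly_almost_periodic_translates_totally_bounded:
  assumes "uniformly_almost_periodic F" "0 < e"
  obtains H where "finite H" "\<And>h. \<exists>h'\<in>H. \<forall>s. norm (F (s + h) - F (s + h')) < e"
proof -
  obtain A c where A: "finite A" "\<And>t. norm (F t - (\<Sum>\<alpha>\<in>A. c \<alpha> * exp (- \<i> * of_real \<alpha> * of_real t))) \<le> e / 4"
    using assms uniformly_almost_periodicE[of F "e / 4"] by auto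
  define p where "p t = (\<Sum>\<alpha>\<in>A. c \<alpha> * exp (- \<i> * of_real \<alpha> * of_real t))" for t
  \<comment> \<open>The summand 1 keeps S positive even when all coefficients vanish.\<close>
  define S where "S = 1 + (\<Sum>\<alpha>\<in>A. norm (c \<alpha>))"
  have S: "0 < S"
    unfolding S_def by (simp add: add_pos_nonneg sum_nonneg)
  obtain H where H: "finite H"
    "\<And>h. \<exists>h'\<in>H. \<forall>\<alpha>\<in>A. norm (exp (- \<i> * of_real \<alpha> * of_real h) - exp (- \<i> * of_real \<alpha> * of_real h')) < e / 4 / S"
    using exp_translates_totally_bounded[OF A(1), of "e / 4 / S"] S assms(2) by auto
  have "\<exists>h'\<in>H. \<forall>s. norm (F (s + h) - F (s + h')) < e" for h
  proof -
    obtain h' where h': "h' \<in> H"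
      "\<And>\<alpha>. \<alpha> \<in> A \<Longrightarrow> norm (exp (- \<i> * of_real \<alpha> * of_real h) - exp (- \<i> * of_real \<alpha> * of_real h')) < e / 4 / S"
      using H(2) by blast
    have "norm (F (s + h) - F (s + h')) < e" for s
    proof -
      have "p (s + h) - p (s + h') = (\<Sum>\<alpha>\<in>A. c \<alpha> * exp (- \<i> * of_real \<alpha> * of_real s) *
          (exp (- \<i> * of_real \<alpha> * of_real h) - exp (- \<i> * of_real \<alpha> * of_real h')))"
        unfolding p_def sum_subtractf[symmetric]
        by (intro sum.cong refl) (simp only: of_real_add distrib_left exp_add right_diff_distrib mult.assoc)
      also have "norm \<dots> \<le> (\<Sum>\<alpha>\<in>A. norm (c \<alpha>) * (e / 4 / S))"
      proof (rule sum_norm_le)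
        fix \<alpha> assume "\<alpha> \<in> A"
        have "norm (c \<alpha>) * norm (exp (- \<i> * of_real \<alpha> * of_real h) - exp (- \<i> * of_real \<alpha> * of_real h'))
            \<le> norm (c \<alpha>) * (e / 4 / S)"
          by (rule mult_left_mono[OF less_imp_le[OF h'(2)] norm_ge_zero]) fact
        then show "norm (c \<alpha> * exp (- \<i> * of_real \<alpha> * of_real s) *
            (exp (- \<i> * of_real \<alpha> * of_real h) - exp (- \<i> * of_real \<alpha> * of_real h'))) \<le> norm (c \<alpha>) * (e / 4 / S)"
          by (simp add: norm_mult norm_exp_eq_Re)
      qed
      also have "\<dots> \<le> S * (e / 4 / S)"
        unfolding sum_distrib_right[symmetric] using S assms(2) by (intro mult_right_mono) (auto simp: S_def)
      finally have "norm (p (s + h) - p (s + h')) \<le> e / 4"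
        using S by simp
      then show ?thesis
        using A(2)[of "s + h", folded p_def] A(2)[of "s + h'", folded p_def] assms(2) by norm
    qed
    with h'(1) show ?thesis
      by blast
  qed
  with H(1) show ?thesis
    using that by blast
qed

text \<open>All Bohr coefficients vanishing forces \<open>\<bar>F\<bar>\<^sup>2\<close> to have mean \<open>0\<close>. Finitely many translates
  approximate all the others, so a point where \<open>F\<close> is large produces a finite sum of translates
  of \<open>\<bar>F\<bar>\<^sup>2\<close> which is bounded below everywhere.\<close>

lemma uniformly_almost_periodic_uniqueness:
  assumes F: "uniformly_almost_periodic F"
    and zero: "\<And>y. has_mean (\<lambda>t. F t * exp (\<i> * of_real y * of_real t)) 0"
  shows "F t0 = 0"
proof (rule ccontr)
  assume "F t0 \<noteq> 0"
  define e where "e = norm (F t0) / 2"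
  have e: "0 < e"
    using \<open>F t0 \<noteq> 0\<close> by (simp add: e_def)
  note cont = uniformly_almost_periodic_continuous[OF F]
  define Q where "Q t = (norm (F t))\<^sup>2" for t
  have Q: "continuous_on UNIV Q" "\<And>t. 0 \<le> Q t"
    unfolding Q_def using cont by (auto intro!: continuous_intros)
  obtain B where B: "0 < B" "\<And>t. norm (F t) \<le> B"
    using uniformly_almost_periodic_bounded[OF F] by blast
  have mean: "has_mean (\<lambda>t. of_real (Q t)) 0"
  proof (rule has_mean_approx)
    show "continuous_on UNIV (\<lambda>t. complex_of_real (Q t))"
      using Q(1) by (intro continuous_intros)
  next
    fix d :: real assume d: "0 < d"
    obtain A c where A: "finite A" "\<And>t. norm (F t - (\<Sum>\<alpha>\<in>A. c \<alpha> * exp (- \<i> * of_real \<alpha> * of_real t))) \<le> d / B"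
      using F d B(1) uniformly_almost_periodicE[of F "d / B"] by auto
    \<comment> \<open>F times the conjugate of an approximating polynomial. Conjugation turns its
      exponentials into those of the Bohr coefficients of F, so G has mean 0 while being d-close to
      |F|^2.\<close>
    define G where "G t = (\<Sum>\<alpha>\<in>A. cnj (c \<alpha>) * (F t * exp (\<i> * of_real \<alpha> * of_real t)))" for t
    have G: "G t = F t * cnj (\<Sum>\<alpha>\<in>A. c \<alpha> * exp (- \<i> * of_real \<alpha> * of_real t))" for t
      by (simp add: G_def sum_distrib_left exp_cnj mult_ac)
    have "norm (of_real (Q t) - G t) \<le> d" for t
    proof -
      have "of_real (Q t) - G t = F t * cnj (F t - (\<Sum>\<alpha>\<in>A. c \<alpha> * exp (- \<i> * of_real \<alpha> * of_real t)))"
        unfolding G Q_def complex_norm_square by (simp add: right_diff_distrib)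
      also have "norm \<dots> \<le> B * (d / B)"
        unfolding norm_mult complex_mod_cnj using A(2)[of t] B by (intro mult_mono) auto
      finally show ?thesis
        using B by simp
    qed
    moreover have "has_mean G (\<Sum>\<alpha>\<in>A. cnj (c \<alpha>) * 0)"
      unfolding G_def using cont by (intro has_mean_sum has_mean_cmult zero A(1)) (auto intro!: continuous_intros)
    moreover have "continuous_on UNIV G"
      unfolding G_def using cont by (intro continuous_intros)
    ultimately show "\<exists>G c. continuous_on UNIV G \<and> has_mean G c
        \<and> (\<forall>t. norm (of_real (Q t) - G t) \<le> d) \<and> norm (0 - c) \<le> d"
      using d by (intro exI[of _ G] exI[of _ 0]) auto
  qed
  have Q_int: "Q integrable_on {a..b}" for a b
    using Q(1) by (intro integrable_continuous_interval) (auto intro: continuous_on_subset)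
  obtain H where H: "finite H" "\<And>h. \<exists>h'\<in>H. \<forall>s. norm (F (s + h) - F (s + h')) < e"
    using uniformly_almost_periodic_translates_totally_bounded[OF F e] by blast
  have lower: "e\<^sup>2 \<le> (\<Sum>h'\<in>H. Q (h + (t0 - h')))" for h
  proof -
    \<comment> \<open>The translates by h and h' are compared at the point t0 - h', where the second
      one takes the large value F t0.\<close>
    obtain h' where h': "h' \<in> H" "norm (F ((t0 - h') + h) - F ((t0 - h') + h')) < e"
      using H(2) by blast
    then have "norm (F ((t0 - h') + h) - F t0) < e"
      by simp
    moreover have "norm (F t0) = 2 * e"
      by (simp add: e_def)
    ultimately have "e \<le> norm (F ((t0 - h') + h))"
      using norm_triangle_ineq3[of "F ((t0 - h') + h)" "F t0"] by linarith
    then have "e \<le> norm (F (h + (t0 - h')))"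
      by (simp only: add.commute)
    then have "e\<^sup>2 \<le> Q (h + (t0 - h'))"
      using e unfolding Q_def by (intro power_mono) auto
    also have "\<dots> \<le> (\<Sum>h'\<in>H. Q (h + (t0 - h')))"
      using h'(1) H(1) Q(2) by (intro member_le_sum) auto
    finally show ?thesis .
  qed
  define n where "n = real (card H)"
  have "H \<noteq> {}"
    using H(2) by blast
  then have n: "0 < n"
    using H(1) by (simp add: n_def card_gt_0_iff)
  \<comment> \<open>The largest shift: for T >= a every shifted interval lies in [-2T, 2T]. Doubling
    the interval costs the factor 2 in the lower bound.\<close>
  define a where "a = Max ((\<lambda>h'. \<bar>t0 - h'\<bar>) ` H)"
  have a: "\<bar>t0 - h'\<bar> \<le> a" if "h' \<in> H" for h'
    unfolding a_def using that H(1) by (intro Max_ge) auto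
  have average_lower: "e\<^sup>2 / (2 * n) \<le> norm (average (2 * T) (\<lambda>t. of_real (Q t)))" if T: "0 < T" "a \<le> T" for T
  proof -
    have "2 * T * e\<^sup>2 = integral {-T..T} (\<lambda>h. e\<^sup>2)"
      using T by simp
    also have "\<dots> \<le> integral {-T..T} (\<lambda>h. \<Sum>h'\<in>H. Q (h + (t0 - h')))"
      using lower by (intro integral_le integrable_continuous_interval continuous_intros
          continuous_on_compose2[OF Q(1)]) auto
    also have "\<dots> = (\<Sum>h'\<in>H. integral {-T..T} (\<lambda>h. Q (h + (t0 - h'))))"
      using H(1) by (intro integral_sum integrable_continuous_interval continuous_intros
          continuous_on_compose2[OF Q(1)]) auto
    also have "\<dots> \<le> (\<Sum>h'\<in>H. integral {-(2 * T)..2 * T} Q)"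
    proof (rule sum_mono)
      fix h' assume "h' \<in> H"
      have "integral {-T..T} (\<lambda>h. Q (h + (t0 - h'))) = integral {-T + (t0 - h')..T + (t0 - h')} Q"
        using integral_shift_real_ivl[of "- T + (t0 - h')" "t0 - h'" "T + (t0 - h')" Q] by simp
      also have "\<dots> \<le> integral {-(2 * T)..2 * T} Q"
        using a[OF \<open>h' \<in> H\<close>] T by (intro integral_subset_le Q_int) (auto simp: Q(2))
      finally show "integral {-T..T} (\<lambda>h. Q (h + (t0 - h'))) \<le> integral {-(2 * T)..2 * T} Q" .
    qed
    also have "\<dots> = n * integral {-(2 * T)..2 * T} Q"
      by (simp add: n_def)
    finally have "e\<^sup>2 / (2 * n) \<le> integral {-(2 * T)..2 * T} Q / (4 * T)"
      using T n by (simp add: field_simps)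
    also have "\<dots> = norm (average (2 * T) (\<lambda>t. of_real (Q t)))"
    proof -
      have "integral {-(2 * T)..2 * T} (\<lambda>t. complex_of_real (Q t)) = of_real (integral {-(2 * T)..2 * T} Q)"
        using has_integral_of_real[OF integrable_integral[OF Q_int]] by (rule integral_unique)
      moreover have "0 \<le> integral {-(2 * T)..2 * T} Q"
        by (intro integral_nonneg Q_int) (simp add: Q(2))
      ultimately show ?thesis
        using T by (simp add: average_def norm_mult norm_divide)
    qed
    finally show ?thesis .
  qed
  have "\<forall>\<^sub>F T in at_top. e\<^sup>2 / (2 * n) \<le> norm (average (2 * T) (\<lambda>t. of_real (Q t)))"
    using eventually_gt_at_top[of 0] eventually_ge_at_top[of a] by eventually_elim (rule average_lower)
  moreover have "filterlim (\<lambda>T::real. 2 * T) at_top at_top"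
    by (rule filterlim_tendsto_pos_mult_at_top[OF tendsto_const _ filterlim_ident]) simp
  from tendsto_norm[OF filterlim_compose[OF mean[unfolded has_mean_def] this]]
  have "((\<lambda>T. norm (average (2 * T) (\<lambda>t. of_real (Q t)))) \<longlongrightarrow> norm (0::complex)) at_top"
    by simp
  ultimately have "e\<^sup>2 / (2 * n) \<le> norm (0::complex)"
    by (intro tendsto_lowerbound[where F = at_top]) auto
  then show False
    using e n by (simp add: divide_le_0_iff)
qed

subsection \<open>Convolution along vertical lines\<close>

lemma open_right_half_plane: "open (right_half_plane \<sigma>)"
  unfolding right_half_plane_def by (rule open_halfspace_Re_gt)

lemma connected_right_half_plane: "connected (right_half_plane \<sigma>)"
  unfolding right_half_plane_def by (rule convex_connected[OF convex_halfspace_Re_gt])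

text \<open>A vertical line accumulates inside the connected half plane, so the identity theorem
  applies. A formula may thus be proved on whichever line is convenient.\<close>

lemma right_half_plane_identity:
  assumes "g holomorphic_on right_half_plane 0" "h holomorphic_on right_half_plane 0" "0 < c"
    and eq: "\<And>t. g (Complex c t) = h (Complex c t)" and "0 < Re s"
  shows "g s = h s"
proof -
  have "Complex c 0 islimpt range (Complex c)"
    unfolding islimpt_approachable
  proof (intro allI impI)
    fix e :: real assume "0 < e"
    then show "\<exists>x'\<in>range (Complex c). x' \<noteq> Complex c 0 \<and> dist x' (Complex c 0) < e"
      by (intro bexI[of _ "Complex c (e / 2)"]) (auto simp: dist_norm cmod_def)
  qed
  note limpt = this
  have hol: "(\<lambda>s. g s - h s) holomorphic_on right_half_plane 0"
    using assms(1,2) by (rule holomorphic_on_diff)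
  have "range (Complex c) \<subseteq> right_half_plane 0" "Complex c 0 \<in> right_half_plane 0" "s \<in> right_half_plane 0"
    using assms(3,5) by (auto simp: right_half_plane_def)
  moreover have "g z - h z = 0" if "z \<in> range (Complex c)" for z
    using that eq by auto
  ultimately have "g s - h s = 0"
    using analytic_continuation[OF hol open_right_half_plane connected_right_half_plane _ _ limpt] by blast
  then show ?thesis
    by simp
qed

text \<open>With v = u / X this integrates X K(X v) f(s + i v): an average along the vertical line
  that concentrates at s for large X. Leaving K unscaled gives majorants that do not move with
  X.\<close>

definition smear :: "(real \<Rightarrow> real) \<Rightarrow> real \<Rightarrow> (complex \<Rightarrow> complex) \<Rightarrow> complex \<Rightarrow> complex" where
  "smear K X f s = (LINT u|lborel. of_real (K u) * f (s + \<i> * of_real (u / X)))"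

lemma measurable_vertical:
  assumes "g holomorphic_on right_half_plane 0" "0 < Re s"
  shows "(\<lambda>u. g (s + \<i> * of_real (u / X))) \<in> borel_measurable borel"
  using assms(2) unfolding divide_inverse
  by (intro borel_measurable_continuous_onI
      continuous_on_compose2[OF holomorphic_on_imp_continuous_on[OF assms(1)]] continuous_intros)
     (auto simp: right_half_plane_def)

section \<open>Bounded holomorphic functions and their averages\<close>

locale bounded_holomorphic =
  fixes f :: "complex \<Rightarrow> complex" and B :: real
  assumes holo: "f holomorphic_on right_half_plane 0"
    and bound: "\<And>s. 0 < Re s \<Longrightarrow> norm (f s) \<le> B"
begin

lemma bound_nonneg: "0 \<le> B"
  using bound[of 1] by (simp add: order_trans[OF norm_ge_zero])

lemma deriv_at: "0 < Re s \<Longrightarrow> (f has_field_derivative deriv f s) (at s within A)"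
  using holomorphic_derivI[OF holo open_right_half_plane] by (simp add: right_half_plane_def)

text \<open>Cauchy's estimate on a disc of radius d / 2 rather than d, because the closed disc has
  to stay inside the open half plane.\<close>

lemma norm_deriv_le:
  assumes "0 < d" "d \<le> Re s"
  shows "norm (deriv f s) \<le> 2 * B / d"
proof -
  have sub: "cball s (d / 2) \<subseteq> right_half_plane 0"
  proof
    fix z assume "z \<in> cball s (d / 2)"
    then have "Re (s - z) \<le> d / 2"
      using complex_Re_le_cmod[of "s - z"] by (simp add: dist_norm)
    then show "z \<in> right_half_plane 0"
      using assms by (simp add: right_half_plane_def)
  qed
  have "norm ((deriv ^^ 1) f s) \<le> fact 1 * B / (d / 2) ^ 1"
  proof (rule Cauchy_inequality)
    show "f holomorphic_on ball s (d / 2)"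
      using sub by (intro holomorphic_on_subset[OF holo]) auto
    show "continuous_on (cball s (d / 2)) f"
      by (intro continuous_on_subset[OF holomorphic_on_imp_continuous_on[OF holo]] sub)
    show "norm (f x) \<le> B" if "norm (s - x) = d / 2" for x
      using that sub by (intro bound) (auto simp: right_half_plane_def subset_iff dist_norm)
  qed (use assms in auto)
  then show ?thesis
    by (simp add: mult.commute)
qed

lemma lipschitz:
  assumes "0 < d" "d \<le> Re s" "d \<le> Re t"
  shows "norm (f s - f t) \<le> 2 * B / d * norm (s - t)"
proof (rule field_differentiable_bound)
  show "convex {z. d \<le> Re z}"
    by (rule convex_halfspace_Re_ge)
qed (use assms deriv_at norm_deriv_le in auto)

context
  fixes K :: "real \<Rightarrow> real"
  assumes K_int: "integrable lborel K" and K_nonneg: "\<And>u. 0 \<le> K u"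
begin

lemma K_measurable: "K \<in> borel_measurable borel"
  using K_int by auto

lemma integrable_smear:
  assumes "g holomorphic_on right_half_plane 0" "0 < Re s"
    and "\<And>u. norm (g (s + \<i> * of_real (u / X))) \<le> C"
  shows "integrable lborel (\<lambda>u. of_real (K u) * g (s + \<i> * of_real (u / X)))"
proof (rule Bochner_Integration.integrable_bound[OF integrable_mult_right[OF K_int, of C]])
  show "(\<lambda>u. of_real (K u) * g (s + \<i> * of_real (u / X))) \<in> borel_measurable lborel"
    using measurable_vertical[OF assms(1,2)] K_measurable by measurable
  have "0 \<le> C"
    using assms(3)[of 0] by (simp add: order_trans[OF norm_ge_zero])
  then show "AE u in lborel. norm (of_real (K u) * g (s + \<i> * of_real (u / X))) \<le> norm (C * K u)"
    using assms(3) K_nonneg by (auto simp: norm_mult mult.commute[of C] intro!: mult_left_mono)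
qed

text \<open>Differentiation under the integral: the difference quotients are dominated by a
  Lipschitz constant of f times K.\<close>

lemma smear_holomorphic: "smear K X f holomorphic_on right_half_plane 0"
proof -
  have "(smear K X f has_field_derivative smear K X (deriv f) s) (at s)" if s: "0 < Re s" for s
    unfolding has_field_derivative_iff tendsto_at_iff_sequentially
  proof (intro allI impI)
    fix Y :: "nat \<Rightarrow> complex"
    assume Y: "\<forall>i. Y i \<in> UNIV - {s}" "Y \<longlonglongrightarrow> s"
    define d where "d = Re s / 2"
    have d: "0 < d" "d < Re s"
      using s by (auto simp: d_def)
    have "(\<lambda>i. Re (Y i)) \<longlonglongrightarrow> Re s"
      using Y(2) by (rule tendsto_Re)
    then have "\<forall>\<^sub>F i in sequentially. d < Re (Y i)"
      using d(2) by (rule order_tendstoD(1))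
    then obtain N where N: "\<And>i. N \<le> i \<Longrightarrow> d < Re (Y i)"
      unfolding eventually_sequentially by blast
    \<comment> \<open>The tail stays in Re > d, so the Lipschitz majorant holds at every index;
      \<open>LIMSEQ_offset\<close> removes the shift at the end.\<close>
    define Z where "Z i = Y (i + N)" for i
    have Z: "Z i \<noteq> s" "d < Re (Z i)" for i
      using Y(1) N by (auto simp: Z_def)
    have Z_lim: "Z \<longlonglongrightarrow> s"
      unfolding Z_def using Y(2) by (rule LIMSEQ_ignore_initial_segment)
    let ?v = "\<lambda>u. \<i> * complex_of_real (u / X)"
    have hold: "deriv f holomorphic_on right_half_plane 0"
      by (rule holomorphic_deriv[OF holo open_right_half_plane])
    have int: "integrable lborel (\<lambda>u. of_real (K u) * f (z + ?v u))" if "0 < Re z" for z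
      using that by (intro integrable_smear[where C = B] holo bound) auto
    have "(\<lambda>i. LINT u|lborel. of_real (K u) * ((f (Z i + ?v u) - f (s + ?v u)) / (Z i - s)))
        \<longlonglongrightarrow> (LINT u|lborel. of_real (K u) * deriv f (s + ?v u))"
    proof (rule integral_dominated_convergence[where w = "\<lambda>u. 2 * B / d * K u"])
      note [measurable] = K_measurable
      have [measurable]: "(\<lambda>u. f (Z i + ?v u)) \<in> borel_measurable borel" for i
        using Z(2)[of i] d by (intro measurable_vertical[OF holo]) auto
      have [measurable]: "(\<lambda>u. f (s + ?v u)) \<in> borel_measurable borel"
        using s by (rule measurable_vertical[OF holo])
      have [measurable]: "(\<lambda>u. deriv f (s + ?v u)) \<in> borel_measurable borel"
        using s by (rule measurable_vertical[OF hold])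
      show "(\<lambda>u. of_real (K u) * deriv f (s + ?v u)) \<in> borel_measurable lborel"
        by measurable
      show "(\<lambda>u. of_real (K u) * ((f (Z i + ?v u) - f (s + ?v u)) / (Z i - s))) \<in> borel_measurable lborel" for i
        by measurable
      show "integrable lborel (\<lambda>u. 2 * B / d * K u)"
        using K_int by simp
      show "AE u in lborel. norm (of_real (K u) * ((f (Z i + ?v u) - f (s + ?v u)) / (Z i - s))) \<le> 2 * B / d * K u" for i
      proof (rule AE_I2)
        fix u
        have "norm (f (Z i + ?v u) - f (s + ?v u)) \<le> 2 * B / d * norm ((Z i + ?v u) - (s + ?v u))"
          using d Z(2)[of i] by (intro lipschitz) auto
        then have "norm ((f (Z i + ?v u) - f (s + ?v u)) / (Z i - s)) \<le> 2 * B / d"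
          using Z(1)[of i] unfolding norm_divide by (subst pos_divide_le_eq) auto
        then have "K u * norm ((f (Z i + ?v u) - f (s + ?v u)) / (Z i - s)) \<le> K u * (2 * B / d)"
          by (rule mult_left_mono) (rule K_nonneg)
        then show "norm (of_real (K u) * ((f (Z i + ?v u) - f (s + ?v u)) / (Z i - s))) \<le> 2 * B / d * K u"
          by (simp only: norm_mult norm_of_real abs_of_nonneg[OF K_nonneg] mult.commute)
      qed
      show "AE u in lborel. (\<lambda>i. of_real (K u) * ((f (Z i + ?v u) - f (s + ?v u)) / (Z i - s)))
          \<longlonglongrightarrow> of_real (K u) * deriv f (s + ?v u)"
      proof (intro AE_I2 tendsto_mult tendsto_const)
        fix u
        have "(f has_field_derivative deriv f (s + ?v u)) (at (s + ?v u))"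
          using s by (intro deriv_at) auto
        then have *: "((\<lambda>y. (f y - f (s + ?v u)) / (y - (s + ?v u))) \<longlongrightarrow> deriv f (s + ?v u)) (at (s + ?v u))"
          by (simp add: has_field_derivative_iff)
        have "filterlim (\<lambda>i. Z i + ?v u) (at (s + ?v u)) sequentially"
          using Z(1) by (intro filterlim_atI tendsto_intros Z_lim) auto
        from filterlim_compose[OF * this]
        show "(\<lambda>i. (f (Z i + ?v u) - f (s + ?v u)) / (Z i - s)) \<longlonglongrightarrow> deriv f (s + ?v u)"
          by simp
      qed
    qed
    moreover have "(LINT u|lborel. of_real (K u) * ((f (Z i + ?v u) - f (s + ?v u)) / (Z i - s)))
        = (smear K X f (Z i) - smear K X f s) / (Z i - s)" for i
    proof -
      have "0 < Re (Z i)"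
        using Z(2)[of i] d by simp
      from Bochner_Integration.integral_diff[OF int[OF this] int[OF s]] show ?thesis
        by (simp only: smear_def times_divide_eq_right right_diff_distrib integral_divide_zero)
    qed
    ultimately have "(\<lambda>i. (smear K X f (Z i) - smear K X f s) / (Z i - s)) \<longlonglongrightarrow> smear K X (deriv f) s"
      by (simp only: smear_def)
    then show "((\<lambda>y. (smear K X f y - smear K X f s) / (y - s)) \<circ> Y) \<longlonglongrightarrow> smear K X (deriv f) s"
      unfolding o_def Z_def by (rule LIMSEQ_offset)
  qed
  then show ?thesis
    by (auto simp: holomorphic_on_def field_differentiable_def right_half_plane_def
        intro: has_field_derivative_at_within)
qed

lemma smear_approx:
  assumes K1: "(LINT u|lborel. K u) = 1" and \<sigma>: "0 < \<sigma>" and e: "0 < e"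
  shows "\<forall>\<^sub>F X in at_top. \<forall>s. \<sigma> \<le> Re s \<longrightarrow> norm (smear K X f s - f s) \<le> e"
proof -
  \<comment> \<open>The majorant does not involve s, hence the uniformity. Its Lipschitz part tends
    to 0 as X grows. The cap 2 B is there because |u| K(u) need not be integrable, and is not for
    the Fejer kernel itself.\<close>
  define w where "w X u = K u * min (2 * B / \<sigma> * \<bar>u / X\<bar>) (2 * B)" for X u
  have w_bound: "0 \<le> w X u" "w X u \<le> 2 * B * K u" for X u
  proof -
    have "0 \<le> min (2 * B / \<sigma> * \<bar>u / X\<bar>) (2 * B)"
      using bound_nonneg \<sigma> by simp
    then show "0 \<le> w X u"
      unfolding w_def by (rule mult_nonneg_nonneg[OF K_nonneg])
    show "w X u \<le> 2 * B * K u"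
      unfolding w_def mult.commute[of _ "K u"] by (intro mult_left_mono K_nonneg) simp
  qed
  note [measurable] = K_measurable
  have [measurable]: "w X \<in> borel_measurable borel" for X
    unfolding w_def by measurable
  have w_int: "integrable lborel (w X)" for X
  proof (rule Bochner_Integration.integrable_bound[OF integrable_mult_right[OF K_int, of "2 * B"]])
    show "AE u in lborel. norm (w X u) \<le> norm (2 * B * K u)"
      using w_bound[of X] by (auto simp only: real_norm_def abs_of_nonneg intro!: AE_I2 order_trans[OF _ abs_ge_self])
  qed simp
  have "((\<lambda>X. LINT u|lborel. w X u) \<longlongrightarrow> integral\<^sup>L lborel (\<lambda>_::real. 0::real)) at_top"
  proof (rule integral_dominated_convergence_at_top[where s = w and f = "\<lambda>_. 0" and w = "\<lambda>u. 2 * B * K u"])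
    show "AE u in lborel. ((\<lambda>X. w X u) \<longlongrightarrow> 0) at_top"
    proof (rule AE_I2)
      fix u :: real
      have "((\<lambda>X. u / X) \<longlongrightarrow> 0) at_top"
        by (intro tendsto_divide_0[OF tendsto_const] filterlim_at_top_imp_at_infinity filterlim_ident)
      then have "((\<lambda>X. K u * min (2 * B / \<sigma> * \<bar>u / X\<bar>) (2 * B)) \<longlongrightarrow> K u * min (2 * B / \<sigma> * \<bar>0\<bar>) (2 * B)) at_top"
        by (intro tendsto_intros)
      then show "((\<lambda>X. w X u) \<longlongrightarrow> 0) at_top"
        using bound_nonneg by (simp add: w_def)
    qed
    show "integrable lborel (\<lambda>u. 2 * B * K u)"
      using K_int by simp
    show "\<forall>\<^sub>F X in at_top. AE u in lborel. norm (w X u) \<le> 2 * B * K u"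
      using w_bound by (simp only: real_norm_def abs_of_nonneg) simp
  qed auto
  then have "\<forall>\<^sub>F X in at_top. (LINT u|lborel. w X u) < e"
    using e by (intro order_tendstoD(2)) auto
  then show ?thesis
  proof eventually_elim
    case (elim X)
    show ?case
    proof (intro allI impI)
      fix s assume s: "\<sigma> \<le> Re s"
      let ?v = "\<lambda>u. \<i> * complex_of_real (u / X)"
      have int: "integrable lborel (\<lambda>u. of_real (K u) * f (s + ?v u))"
        using s \<sigma> by (intro integrable_smear[where C = B] holo bound) auto
      have int': "integrable lborel (\<lambda>u. of_real (K u) * f s)"
        using K_int by (intro integrable_mult_left integrable_of_real)
      have "(LINT u|lborel. of_real (K u) * f s) = f s"
        using K1 K_int by simp
      then have "smear K X f s - f s = (LINT u|lborel. of_real (K u) * f (s + ?v u) - of_real (K u) * f s)"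
        unfolding smear_def using int int' by simp
      also have "norm \<dots> \<le> (LINT u|lborel. w X u)"
      proof (rule Bochner_Integration.integral_norm_bound_integral)
        show "integrable lborel (\<lambda>u. of_real (K u) * f (s + ?v u) - of_real (K u) * f s)"
          using int int' by simp
        fix u
        have "norm (f (s + ?v u) - f s) \<le> 2 * B / \<sigma> * norm ((s + ?v u) - s)"
          using s \<sigma> by (intro lipschitz) auto
        moreover have "norm ((s + ?v u) - s) = \<bar>u / X\<bar>"
          by (simp only: add_diff_cancel_left' norm_mult norm_ii norm_of_real mult_1)
        moreover have "norm (f (s + ?v u) - f s) \<le> 2 * B"
          using bound[of "s + ?v u"] bound[of s] s \<sigma> norm_triangle_ineq4[of "f (s + ?v u)" "f s"] by simp
        ultimately have "K u * norm (f (s + ?v u) - f s) \<le> w X u"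
          unfolding w_def by (intro mult_left_mono K_nonneg) (simp only: min.bounded_iff)
        then show "norm (of_real (K u) * f (s + ?v u) - of_real (K u) * f s) \<le> w X u"
          by (simp only: right_diff_distrib[symmetric] norm_mult norm_of_real abs_of_nonneg[OF K_nonneg])
      qed (rule w_int)
      finally show "norm (smear K X f s - f s) \<le> e"
        using elim by simp
    qed
  qed
qed

end

end

lemma smear_exp:
  "smear K X (\<lambda>s. exp (- of_real l * s)) s = exp (- of_real l * s) * transform K (l / X)"
proof -
  have "of_real (K u) * exp (- of_real l * (s + \<i> * of_real (u / X)))
      = exp (- of_real l * s) * (of_real (K u) * exp (- \<i> * of_real (l / X) * of_real u))" for u
    unfolding mult.left_commute[of "exp (- of_real l * s)"] exp_add[symmetric] by (simp add: algebra_simps)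
  then show ?thesis
    by (simp only: smear_def transform_def integral_mult_right_zero)
qed

lemma bounded_holomorphicI:
  assumes "f holomorphic_on right_half_plane 0" "bounded (f ` right_half_plane 0)"
  obtains B where "bounded_holomorphic f B"
proof -
  obtain B where "\<And>s. s \<in> right_half_plane 0 \<Longrightarrow> norm (f s) \<le> B"
    using assms(2) by (auto simp: bounded_iff)
  then have "bounded_holomorphic f B"
    using assms(1) by (auto simp: bounded_holomorphic_def right_half_plane_def)
  then show ?thesis
    by (rule that)
qed

subsection \<open>Riesz means\<close>

text \<open>Extended by 0 beyond x, so that the means for all x <= y become sums over one index
  set.\<close>

definition riesz_weight :: "real \<Rightarrow> real \<Rightarrow> real \<Rightarrow> real" where
  "riesz_weight m x t = (if t < x then (1 - t / x) powr m else 0)"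

lemma riesz_weight_bounds:
  assumes "0 \<le> m" "0 \<le> t"
  shows "0 \<le> riesz_weight m x t" "riesz_weight m x t \<le> 1"
  using assms by (auto simp: riesz_weight_def intro!: powr_le1)

lemma finite_frequency_less: "frequency l \<Longrightarrow> finite {n. l n < x}"
proof -
  assume "frequency l"
  then have "\<forall>\<^sub>F n in sequentially. x \<le> l n"
    by (auto simp: frequency_def filterlim_at_top)
  then obtain N where "\<And>n. N \<le> n \<Longrightarrow> x \<le> l n"
    unfolding eventually_sequentially by blast
  then have "{n. l n < x} \<subseteq> {..<N}"
    by (auto simp: not_le[symmetric])
  then show ?thesis
    using finite_subset by blast
qed

lemma riesz_mean_eq_weighted_sum:
  assumes "frequency l" "x \<le> y"
  shows "riesz_mean l a m x s
    = (\<Sum>n | l n < y. a n * exp (- of_real (l n) * s) * of_real (riesz_weight m x (l n)))"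
  unfolding riesz_mean_def using assms(2)
  by (intro sum.mono_neutral_cong_left finite_frequency_less[OF assms(1)]) (auto simp: riesz_weight_def)

text \<open>Convergence bounds the means for large x; for smaller x only a fixed finite set of terms
  enters, with weights in [0, 1]. Integrals over the parameter need a bound valid for every
  x.\<close>

lemma riesz_mean_bounded:
  assumes l: "frequency l" and m: "0 \<le> m" and lim: "((\<lambda>x. riesz_mean l a m x s) \<longlongrightarrow> L) at_top"
  obtains C where "0 \<le> C" "\<And>x. norm (riesz_mean l a m x s) \<le> C"
proof -
  have "\<forall>\<^sub>F x in at_top. norm (riesz_mean l a m x s) < norm L + 1"
    by (rule order_tendstoD(2)[OF tendsto_norm[OF lim]]) simp
  then obtain y where y: "\<And>x. y \<le> x \<Longrightarrow> norm (riesz_mean l a m x s) < norm L + 1"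
    unfolding eventually_at_top_linorder by blast
  define C where "C = (\<Sum>n | l n < y. norm (a n * exp (- of_real (l n) * s)))"
  have C: "0 \<le> C"
    unfolding C_def by (intro sum_nonneg norm_ge_zero)
  have "norm (riesz_mean l a m x s) \<le> norm L + 1 + C" for x
  proof (cases "y \<le> x")
    case False
    have "0 \<le> l n" for n
      using l by (simp add: frequency_def)
    then have "norm (riesz_mean l a m x s) \<le> C"
      using False riesz_weight_bounds[OF m] unfolding C_def
      by (subst riesz_mean_eq_weighted_sum[OF l, of x y])
         (auto intro!: sum_norm_le mult_left_le simp: norm_mult[of _ "of_real _"])
    then show ?thesis
      using norm_ge_zero[of L] by linarith
  qed (use y[of x] C in linarith)
  with C show ?thesis
    using that[of "norm L + 1 + C"] norm_ge_zero[of L] by fastforce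
qed

section \<open>Raising the order of Riesz means\<close>

text \<open>With c = t / y the integrand is (v - c)^m (1 - v)^(p - 1) on [c, 1] and 0 to the left of
  c: a Beta integral moved to [c, 1]. It exhibits the weight of order m + p as an average of weights
  of order m.\<close>

lemma has_integral_riesz_weight:
  assumes "0 \<le> m" "0 < p" "0 \<le> t" "t < y"
  shows "((\<lambda>v. v powr m * (1 - v) powr (p - 1) * riesz_weight m (y * v) t)
    has_integral (Beta (m + 1) p * (1 - t / y) powr (m + p))) {0..1}"
proof -
  define c where "c = t / y"
  have c: "0 \<le> c" "c < 1" "0 < y"
    using assms by (auto simp: c_def)
  have "((\<lambda>v. v powr m * (1 - v) powr (p - 1)) has_integral Beta (m + 1) p) (cbox 0 1)"
    using has_integral_Beta_real[of "m + 1" p] assms by simp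
  from has_integral_affinity[OF this, of "1 / (1 - c)" "- c / (1 - c)"]
  have "((\<lambda>v. (v / (1 - c) - c / (1 - c)) powr m * (1 - (v / (1 - c) - c / (1 - c))) powr (p - 1))
      has_integral (1 - c) * Beta (m + 1) p) ((\<lambda>x. (1 - c) * x + c) ` {0..1})"
    using c by simp
  moreover have "(\<lambda>x. (1 - c) * x + c) ` {0..1} = {c..1}"
    using c by (simp add: image_affinity_atLeastAtMost)
  \<comment> \<open>The factor clears the denominators 1 - c of both powers.\<close>
  ultimately have scaled: "((\<lambda>v. (1 - c) powr (m + p - 1) *
      ((v / (1 - c) - c / (1 - c)) powr m * (1 - (v / (1 - c) - c / (1 - c))) powr (p - 1)))
      has_integral (1 - c) powr (m + p - 1) * ((1 - c) * Beta (m + 1) p)) {c..1}"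
    by (intro has_integral_mult_right) simp
  have value_eq: "(1 - c) powr (m + p - 1) * ((1 - c) * Beta (m + 1) p) = Beta (m + 1) p * (1 - c) powr (m + p)"
    using c by (simp add: powr_diff)
  have fun_eq: "(1 - c) powr (m + p - 1) *
      ((v / (1 - c) - c / (1 - c)) powr m * (1 - (v / (1 - c) - c / (1 - c))) powr (p - 1))
      = v powr m * (1 - v) powr (p - 1) * riesz_weight m (y * v) t" if "v \<in> {c..1}" for v
  proof -
    have "v / (1 - c) - c / (1 - c) = (v - c) / (1 - c)"
      by (simp add: diff_divide_distrib)
    moreover from this have "1 - (v / (1 - c) - c / (1 - c)) = (1 - v) / (1 - c)"
      using c by (simp add: field_simps)
    moreover have "(1 - c) powr (m + p - 1) = (1 - c) powr m * (1 - c) powr (p - 1)"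
      by (simp add: powr_add[symmetric] algebra_simps)
    ultimately have "(1 - c) powr (m + p - 1) *
      ((v / (1 - c) - c / (1 - c)) powr m * (1 - (v / (1 - c) - c / (1 - c))) powr (p - 1))
      = (v - c) powr m * (1 - v) powr (p - 1)"
      using c that by (simp add: powr_divide)
    also have "(v - c) powr m = v powr m * riesz_weight m (y * v) t"
    proof (cases "c < v")
      case True
      have "0 < v"
        using True c by simp
      then have "v - c = v * (1 - t / (y * v))"
        using c by (simp add: c_def right_diff_distrib)
      moreover have "t < y * v"
        using True c(3) by (simp add: c_def field_simps)
      moreover have "0 \<le> 1 - t / (y * v)"
        using \<open>t < y * v\<close> assms by simp
      ultimately show ?thesis
        using True c by (simp add: riesz_weight_def powr_mult)
    next
      \<comment> \<open>At v = c the weight is 0 because its inequality is strict. The left side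
        agrees even for m = 0, since \<open>0 powr 0 = 0\<close>.\<close>
      case False
      then have "v = c"
        using that by simp
      then show ?thesis
        using c by (simp add: riesz_weight_def c_def)
    qed
    finally show ?thesis
      by (simp only: mult_ac)
  qed
  have on_c1: "((\<lambda>v. v powr m * (1 - v) powr (p - 1) * riesz_weight m (y * v) t)
      has_integral (Beta (m + 1) p * (1 - c) powr (m + p))) {c..1}"
    by (rule has_integral_eq[OF fun_eq scaled[unfolded value_eq]])
  have "v powr m * (1 - v) powr (p - 1) * riesz_weight m (y * v) t = 0" if "v \<notin> {c..1}" "v \<in> {0..1}" for v
  proof -
    have "y * v < t"
      using that c by (simp add: c_def field_simps)
    then show ?thesis
      by (simp add: riesz_weight_def)
  qed
  then have "((\<lambda>v. v powr m * (1 - v) powr (p - 1) * riesz_weight m (y * v) t)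
      has_integral (Beta (m + 1) p * (1 - c) powr (m + p))) {0..1}"
    using c(1) by (intro has_integral_eq[OF _ has_integral_restrict[THEN iffD2, OF _ on_c1]]) auto
  then show ?thesis
    by (simp only: c_def)
qed

text \<open>Up to the Beta factor, the mean of order m + p at y averages the means of order m at y v
  over v in [0, 1], with a weight independent of y. For v > 0 the argument y v tends to infinity
  with y, and the global bound C allows dominated convergence.\<close>

lemma riesz_mean_raise:
  assumes l: "frequency l" and m: "0 \<le> m" and p: "0 < p"
    and lim: "((\<lambda>x. riesz_mean l a m x s) \<longlongrightarrow> L) at_top"
  shows "((\<lambda>x. riesz_mean l a (m + p) x s) \<longlongrightarrow> L) at_top"
proof -
  let ?B = "Beta (m + 1) p" and ?w = "\<lambda>v. v powr m * (1 - v) powr (p - 1)"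
  have B: "?B > 0"
    using m p by (simp add: Beta_def)
  have w: "(?w has_integral ?B) {0..1}"
    using has_integral_Beta_real[of "m + 1" p] m p by simp
  obtain C where C: "0 \<le> C" "\<And>x. norm (riesz_mean l a m x s) \<le> C"
    using riesz_mean_bounded[OF l m lim] by blast
  have mean: "((\<lambda>v. of_real (?w v) * riesz_mean l a m (y * v) s)
      has_integral (of_real ?B * riesz_mean l a (m + p) y s)) {0..1}" if y: "0 < y" for y
  proof -
    have weighted: "((\<lambda>v. \<Sum>n | l n < y. a n * exp (- of_real (l n) * s) * of_real (?w v * riesz_weight m (y * v) (l n)))
        has_integral (\<Sum>n | l n < y. a n * exp (- of_real (l n) * s) * of_real (?B * (1 - l n / y) powr (m + p)))) {0..1}"
      using l by (intro has_integral_sum finite_frequency_less[OF l] has_integral_mult_right has_integral_of_real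
          has_integral_riesz_weight m p) (auto simp: frequency_def)
    have value_eq: "(\<Sum>n | l n < y. a n * exp (- of_real (l n) * s) * of_real (?B * (1 - l n / y) powr (m + p)))
        = of_real ?B * riesz_mean l a (m + p) y s"
      unfolding riesz_mean_def sum_distrib_left by (intro sum.cong refl) (simp only: of_real_mult mult_ac)
    have fun_eq: "(\<Sum>n | l n < y. a n * exp (- of_real (l n) * s) * of_real (?w v * riesz_weight m (y * v) (l n)))
        = of_real (?w v) * riesz_mean l a m (y * v) s" if "v \<in> {0..1}" for v
    proof -
      have "y * v \<le> y"
        using that y by (simp add: mult_left_le)
      then show ?thesis
        unfolding riesz_mean_eq_weighted_sum[OF l \<open>y * v \<le> y\<close>] sum_distrib_left
        by (intro sum.cong refl) (simp only: of_real_mult mult_ac)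
    qed
    show ?thesis
      by (rule has_integral_eq[OF fun_eq weighted[unfolded value_eq]])
  qed
  have "((\<lambda>y. of_real ?B * riesz_mean l a (m + p) y s) \<longlongrightarrow> of_real ?B * L) at_top"
  proof (rule tendsto_at_topI_sequentially)
    fix Y :: "nat \<Rightarrow> real" assume Y: "filterlim Y at_top sequentially"
    then have "\<forall>\<^sub>F i in sequentially. 0 < Y i"
      by (simp add: filterlim_at_top_dense)
    then obtain N where N: "\<And>i. N \<le> i \<Longrightarrow> 0 < Y i"
      unfolding eventually_sequentially by blast
    define Z where "Z i = Y (i + N)" for i
    have Z: "0 < Z i" for i
      using N by (simp add: Z_def)
    have Z_lim: "filterlim Z at_top sequentially"
      unfolding Z_def using filterlim_compose[OF Y filterlim_add_const_nat_at_top] .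
    have "(\<lambda>i. integral {0..1} (\<lambda>v. of_real (?w v) * riesz_mean l a m (Z i * v) s))
        \<longlonglongrightarrow> integral {0..1} (\<lambda>v. of_real (?w v) * L)"
    proof (rule dominated_convergence(2)[where h = "\<lambda>v. ?w v * C"])
      show "(\<lambda>v. of_real (?w v) * riesz_mean l a m (Z i * v) s) integrable_on {0..1}" for i
        using mean[OF Z] by (rule has_integral_integrable)
      show "(\<lambda>v. ?w v * C) integrable_on {0..1}"
        using has_integral_mult_left[OF w] by (rule has_integral_integrable)
      show "norm (of_real (?w v) * riesz_mean l a m (Z i * v) s) \<le> ?w v * C" if "v \<in> {0..1}" for i v
        using C(2)[of "Z i * v"] by (simp add: norm_mult mult_left_mono)
      show "(\<lambda>i. of_real (?w v) * riesz_mean l a m (Z i * v) s) \<longlonglongrightarrow> of_real (?w v) * L" if "v \<in> {0..1}" for v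
      \<comment> \<open>At v = 0 the argument does not grow, but the weight vanishes there, for m =
        0 again through \<open>0 powr 0 = 0\<close>.\<close>
      proof (cases "v = 0")
        case False
        then have "filterlim (\<lambda>i. Z i * v) at_top sequentially"
          using that Z_lim filterlim_tendsto_pos_mult_at_top[OF tendsto_const[of v]] by (simp add: mult.commute)
        then show ?thesis
          by (intro tendsto_mult tendsto_const filterlim_compose[OF lim])
      qed simp
    qed
    moreover have "integral {0..1} (\<lambda>v. of_real (?w v) * riesz_mean l a m (Z i * v) s)
        = of_real ?B * riesz_mean l a (m + p) (Z i) s" for i
      using mean[OF Z] by (rule integral_unique)
    moreover have "integral {0..1} (\<lambda>v. of_real (?w v) * L) = of_real ?B * L"
      using has_integral_mult_left[OF has_integral_of_real[OF w]] by (rule integral_unique)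
    ultimately have "(\<lambda>i. of_real ?B * riesz_mean l a (m + p) (Z i) s) \<longlonglongrightarrow> of_real ?B * L"
      by (simp only:)
    then show "(\<lambda>i. of_real ?B * riesz_mean l a (m + p) (Y i) s) \<longlonglongrightarrow> of_real ?B * L"
      unfolding Z_def by (rule LIMSEQ_offset)
  qed
  then have "((\<lambda>y. of_real ?B * riesz_mean l a (m + p) y s / of_real ?B) \<longlongrightarrow> of_real ?B * L / of_real ?B) at_top"
    using B by (intro tendsto_divide tendsto_const) auto
  then show ?thesis
    using B by simp
qed

section \<open>Growth of Riesz means along vertical lines\<close>

text \<open>The polynomial P_j for which e^(w (x - y)) P_j(x) is the j-th derivative of e^(w (x -
  y)) x^k. In the variable t = y - x the latter function is e^(-w t) (y - t)^k.\<close>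

fun exp_monom_deriv :: "complex \<Rightarrow> nat \<Rightarrow> nat \<Rightarrow> complex poly" where
  "exp_monom_deriv w k 0 = monom 1 k"
| "exp_monom_deriv w k (Suc j) = smult w (exp_monom_deriv w k j) + pderiv (exp_monom_deriv w k j)"

lemma exp_monom_deriv_has_derivative:
  "((\<lambda>x. exp (w * (x - y)) * poly (exp_monom_deriv w k j) x) has_field_derivative
    exp (w * (x - y)) * poly (exp_monom_deriv w k (Suc j)) x) (at x)"
  by (auto intro!: derivative_eq_intros simp: algebra_simps)

text \<open>Each differentiation lowers the order of the zero at 0, initially k, by at most
  one.\<close>

lemma coeff_exp_monom_deriv_low: "i + j < k \<Longrightarrow> coeff (exp_monom_deriv w k j) i = 0"
  by (induction j arbitrary: i) (auto simp: coeff_pderiv)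

lemma coeff_exp_monom_deriv_high: "k < i \<Longrightarrow> coeff (exp_monom_deriv w k j) i = 0"
  by (induction j arbitrary: i) (auto simp: coeff_pderiv)

text \<open>The lowest term comes from differentiating x^k alone, so it is free of w; the case j = k
  gives the value k! at 0.\<close>

lemma coeff_exp_monom_deriv_lowest:
  "j \<le> k \<Longrightarrow> fact (k - j) * coeff (exp_monom_deriv w k j) (k - j) = fact k"
proof (induction j)
  case (Suc j)
  then have "k - j = Suc (k - Suc j)"
    by simp
  with Suc show ?case
    by (simp add: coeff_pderiv coeff_exp_monom_deriv_low mult_ac)
qed simp

text \<open>In the sum norm of the coefficients, multiplication by w costs |w| and differentiation
  at most k, as the degree never exceeds k.\<close>

lemma sum_norm_coeff_exp_monom_deriv:
  "(\<Sum>i\<le>k. norm (coeff (exp_monom_deriv w k j) i)) \<le> (norm w + real k) ^ j"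
proof (induction j)
  case (Suc j)
  let ?c = "\<lambda>i. norm (coeff (exp_monom_deriv w k j) i)"
  have "norm (coeff (exp_monom_deriv w k (Suc j)) i) \<le> norm w * ?c i + real (Suc i) * ?c (Suc i)" for i
    by (simp add: coeff_pderiv norm_mult flip: of_nat_Suc) (metis norm_mult norm_of_nat norm_triangle_ineq)
  then have "(\<Sum>i\<le>k. norm (coeff (exp_monom_deriv w k (Suc j)) i))
      \<le> (\<Sum>i\<le>k. norm w * ?c i + real (Suc i) * ?c (Suc i))"
    by (rule sum_mono)
  also have "\<dots> = norm w * (\<Sum>i\<le>k. ?c i) + (\<Sum>i\<le>k. real (Suc i) * ?c (Suc i))"
    by (simp add: sum.distrib sum_distrib_left)
  also have "(\<Sum>i\<le>k. real (Suc i) * ?c (Suc i)) = (\<Sum>i<k. real (Suc i) * ?c (Suc i))"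
    by (simp add: lessThan_Suc_atMost[symmetric] coeff_exp_monom_deriv_high)
  also have "\<dots> \<le> (\<Sum>i<k. real k * ?c (Suc i))"
    by (intro sum_mono mult_right_mono) auto
  also have "\<dots> = real k * (\<Sum>i\<in>Suc ` {..<k}. ?c i)"
    by (simp add: sum_distrib_left sum.reindex)
  also have "\<dots> \<le> real k * (\<Sum>i\<le>k. ?c i)"
    by (intro mult_left_mono sum_mono2) auto
  also have "norm w * (\<Sum>i\<le>k. ?c i) + real k * (\<Sum>i\<le>k. ?c i) = (norm w + real k) * (\<Sum>i\<le>k. ?c i)"
    by (simp add: distrib_right)
  also have "\<dots> \<le> (norm w + real k) * (norm w + real k) ^ j"
    using Suc.IH by (intro mult_left_mono) auto
  finally show ?case
    by simp
qed (simp add: if_distrib sum.delta cong: if_cong)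

lemma norm_poly_exp_monom_deriv_le:
  assumes "0 \<le> x"
  shows "norm (poly (exp_monom_deriv w k j) (of_real x)) \<le> (norm w + real k) ^ j * (1 + x) ^ k"
proof -
  have "degree (exp_monom_deriv w k j) \<le> k"
    by (rule degree_le) (simp add: coeff_exp_monom_deriv_high)
  then have "poly (exp_monom_deriv w k j) (of_real x) = (\<Sum>i\<le>k. coeff (exp_monom_deriv w k j) i * of_real x ^ i)"
    by (simp add: poly_altdef) (intro sum.mono_neutral_left, auto simp: coeff_eq_0)
  also have "norm \<dots> \<le> (\<Sum>i\<le>k. norm (coeff (exp_monom_deriv w k j) i) * (1 + x) ^ k)"
  proof (rule sum_norm_le)
    fix i assume "i \<in> {..k}"
    then have "x ^ i \<le> (1 + x) ^ k"
      using assms power_mono[of x "1 + x" i] power_increasing[of i k "1 + x"] by auto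
    then show "norm (coeff (exp_monom_deriv w k j) i * of_real x ^ i)
        \<le> norm (coeff (exp_monom_deriv w k j) i) * (1 + x) ^ k"
      using assms by (simp add: norm_mult norm_power mult_left_mono)
  qed
  also have "\<dots> \<le> (norm w + real k) ^ j * (1 + x) ^ k"
    unfolding sum_distrib_right[symmetric] using assms
    by (intro mult_right_mono sum_norm_coeff_exp_monom_deriv) auto
  finally show ?thesis .
qed

text \<open>Taylor's formula at x = 0 with integral remainder, evaluated at b = y - t: derivatives
  of order below k vanish and the k-th contributes e^(-w y) b^k. The remainder kernel (b - x)^k is
  the unnormalized Riesz weight with parameter y - x at t, so summing over the frequencies produces
  Riesz means again.\<close>

lemma exp_monom_Taylor:
  fixes w :: complex
  assumes "t < y" "0 \<le> t" and k: "0 < k"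
  shows "((\<lambda>x. of_real ((if t < y - x then y - x - t else 0) ^ k / fact k)
      * (exp (w * of_real (x - y)) * poly (exp_monom_deriv w k (Suc k)) (of_real x)))
    has_integral (exp (- w * of_real t) - exp (- w * of_real y)) * of_real (y - t) ^ k) {0..y}"
proof -
  define b where "b = y - t"
  define D where "D j x = exp (w * of_real (x - y)) * poly (exp_monom_deriv w k j) (of_real x)" for j and x :: real
  have b: "0 < b" "b \<le> y"
    using assms by (auto simp: b_def)
  have "((\<lambda>x. ((b - x) ^ (Suc k - 1) / fact (Suc k - 1)) *\<^sub>R D (Suc k) x)
      has_integral D 0 b - (\<Sum>i<Suc k. ((b - 0) ^ i / fact i) *\<^sub>R D i 0)) {0..b}"
  proof (rule Taylor_has_integral)
    fix j x assume "j < Suc k" "0 \<le> x" "x \<le> b"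
    show "(D j has_vector_derivative D (Suc j) x) (at x within {0..b})"
      using has_vector_derivative_real_field[OF exp_monom_deriv_has_derivative[of w "of_real y" k j "of_real x"]]
      unfolding D_def by simp
  qed (use b in auto)
  moreover have "(\<Sum>i<Suc k. ((b - 0) ^ i / fact i) *\<^sub>R D i 0) = exp (- w * of_real y) * of_real b ^ k"
  proof -
    have "D i 0 = 0" if "i < k" for i
      using that coeff_exp_monom_deriv_low[of 0 i k w] by (simp add: D_def poly_0_coeff_0)
    moreover have "D k 0 = exp (- w * of_real y) * fact k"
      using coeff_exp_monom_deriv_lowest[of k k w] by (simp add: D_def poly_0_coeff_0)
    ultimately show ?thesis
      by (simp add: scaleR_conv_of_real)
  qed
  moreover have "D 0 b = exp (- w * of_real t) * of_real b ^ k"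
    by (simp add: D_def poly_monom b_def)
  ultimately have "((\<lambda>x. ((b - x) ^ k / fact k) *\<^sub>R D (Suc k) x)
      has_integral (exp (- w * of_real t) - exp (- w * of_real y)) * of_real b ^ k) {0..b}"
    by (simp add: left_diff_distrib)
  then have "((\<lambda>x. of_real ((if t < y - x then y - x - t else 0) ^ k / fact k) * D (Suc k) x)
      has_integral (exp (- w * of_real t) - exp (- w * of_real y)) * of_real b ^ k) {0..b}"
    by (rule has_integral_eq[rotated]) (auto simp: scaleR_conv_of_real b_def algebra_simps)
  \<comment> \<open>Since k > 0, the truncated kernel is 0 for x >= b, so the range [0, b] can be
    extended to [0, y], the same for all t.\<close>
  then show ?thesis
    unfolding D_def b_def[symmetric] using k b
    by (subst (asm) has_integral_restrict[of _ "{0..y}", symmetric], simp)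
       (erule has_integral_eq[rotated], auto simp: b_def)
qed

lemma power_div_fact_le_exp:
  assumes "0 \<le> (x::real)"
  shows "x ^ k / fact k \<le> exp x"
  using sum_le_suminf[OF summable_exp[of x], of "{k}"] assms
  by (simp add: exp_def scaleR_conv_of_real field_simps)

text \<open>The series at \<open>s\<^sub>0 + w\<close> is expressed through the Riesz means of the same order at \<open>s\<^sub>0\<close> by
  expanding \<open>t \<mapsto> e\<^sup>-\<^sup>w\<^sup>t (y - t)\<^sup>k\<close> at \<open>t = y\<close>, where all derivatives of order below \<open>k\<close> vanish.\<close>

lemma riesz_mean_polynomial_bound:
  assumes l: "frequency l" and k: "0 < k" and C: "\<And>x. norm (riesz_mean l a (real k) x s\<^sub>0) \<le> C"
    and y: "1 \<le> y" and w: "2 \<le> Re w"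
  shows "norm (riesz_mean l a (real k) y (s\<^sub>0 + w)) \<le> C * (1 + 2 ^ k * (norm w + real k) ^ Suc k)"
proof -
  have C0: "0 \<le> C"
    using C[of 0] by (rule order_trans[OF norm_ge_zero])
  have l0: "0 \<le> l n" for n
    using l by (simp add: frequency_def)
  have riesz: "of_real (x ^ k) * riesz_mean l a (real k) x s
      = (\<Sum>n | l n < y. a n * exp (- of_real (l n) * s) * of_real ((if l n < x then x - l n else 0) ^ k))"
    if "x \<le> y" for x s
  proof -
    have "x ^ k * riesz_weight (real k) x (l n) = (if l n < x then x - l n else 0) ^ k" for n
    proof (cases "l n < x")
      case True
      then have "0 < x" "0 < 1 - l n / x"
        using l0[of n] by auto
      then have "x ^ k * (1 - l n / x) powr real k = (x * (1 - l n / x)) ^ k"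
        by (simp add: powr_realpow power_mult_distrib)
      also have "x * (1 - l n / x) = x - l n"
        using \<open>0 < x\<close> by (simp add: right_diff_distrib)
      finally show ?thesis
        using True by (simp add: riesz_weight_def)
    qed (use k in \<open>simp add: riesz_weight_def\<close>)
    note * = this
    show ?thesis
      unfolding riesz_mean_eq_weighted_sum[OF l that] sum_distrib_left *[symmetric] of_real_mult
      by (intro sum.cong refl) (simp only: mult_ac)
  qed
  let ?D = "\<lambda>x. exp (w * of_real (x - y)) * poly (exp_monom_deriv w k (Suc k)) (of_real x)"
  let ?F = "\<lambda>x. of_real ((y - x) ^ k / fact k) * riesz_mean l a (real k) (y - x) s\<^sub>0 * ?D x"
  \<comment> \<open>The subtracted term is the contribution of the k-th derivative; R is the pure
    remainder.\<close>
  define R where "R = of_real (y ^ k) * riesz_mean l a (real k) y (s\<^sub>0 + w)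
    - exp (- w * of_real y) * (of_real (y ^ k) * riesz_mean l a (real k) y s\<^sub>0)"
  have expansion: "((\<lambda>x. \<Sum>n | l n < y. a n * exp (- of_real (l n) * s\<^sub>0) *
      (of_real ((if l n < y - x then y - x - l n else 0) ^ k / fact k) * ?D x))
    has_integral (\<Sum>n | l n < y. a n * exp (- of_real (l n) * s\<^sub>0) *
      ((exp (- w * of_real (l n)) - exp (- w * of_real y)) * of_real (y - l n) ^ k))) {0..y}"
    using k l0 by (intro has_integral_sum finite_frequency_less[OF l] has_integral_mult_right exp_monom_Taylor) auto
  have value_eq: "(\<Sum>n | l n < y. a n * exp (- of_real (l n) * s\<^sub>0) *
      ((exp (- w * of_real (l n)) - exp (- w * of_real y)) * of_real (y - l n) ^ k)) = R"
    unfolding R_def riesz[OF order_refl] sum_distrib_left sum_subtractf[symmetric]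
    by (intro sum.cong refl) (simp add: exp_add[symmetric] algebra_simps)
  have fun_eq: "(\<Sum>n | l n < y. a n * exp (- of_real (l n) * s\<^sub>0) *
      (of_real ((if l n < y - x then y - x - l n else 0) ^ k / fact k) * ?D x)) = ?F x" if "x \<in> {0..y}" for x
  proof -
    have "y - x \<le> y"
      using that by simp
    have "?F x = (of_real ((y - x) ^ k) * riesz_mean l a (real k) (y - x) s\<^sub>0) * (?D x / of_real (fact k))"
      by simp
    also have "\<dots> = (\<Sum>n | l n < y. a n * exp (- of_real (l n) * s\<^sub>0) *
        of_real ((if l n < y - x then y - x - l n else 0) ^ k) * (?D x / of_real (fact k)))"
      unfolding riesz[OF \<open>y - x \<le> y\<close>] sum_distrib_right ..
    finally show ?thesis
      by (simp only: of_real_divide times_divide_eq_right times_divide_eq_left mult.assoc)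
  qed
  have F: "(?F has_integral R) {0..y}"
    by (rule has_integral_eq[OF fun_eq expansion[unfolded value_eq]])
  define M where "M = C * ((norm w + real k) ^ Suc k * (1 + y) ^ k)"
  have M: "0 \<le> M"
    unfolding M_def using C0 y by (intro mult_nonneg_nonneg) auto
  have F_le: "norm (?F x) \<le> M * exp (x - y)" if "x \<in> {0..y}" for x
  proof -
    have x: "0 \<le> x" "x \<le> y"
      using that by auto
    have "norm (?F x) = (y - x) ^ k / fact k * norm (riesz_mean l a (real k) (y - x) s\<^sub>0)
        * (exp (Re w * (x - y)) * norm (poly (exp_monom_deriv w k (Suc k)) (of_real x)))"
      using x by (simp add: norm_mult norm_divide norm_power norm_exp_eq_Re flip: of_real_diff)
    \<comment> \<open>The factor (y - x)^k / k! is traded for e^(y - x). Re w >= 2 beats it and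
      leaves e^(x - y), whose integral over [0, y] is below 1.\<close>
    also have "\<dots> \<le> exp (y - x) * C * (exp (2 * (x - y)) * ((norm w + real k) ^ Suc k * (1 + y) ^ k))"
    proof (intro mult_mono C)
      show "(y - x) ^ k / fact k \<le> exp (y - x)"
        using x by (intro power_div_fact_le_exp) simp
      show "exp (Re w * (x - y)) \<le> exp (2 * (x - y))"
        using x w by (intro exp_le_cancel_iff[THEN iffD2] mult_right_mono_neg) auto
      show "norm (poly (exp_monom_deriv w k (Suc k)) (of_real x)) \<le> (norm w + real k) ^ Suc k * (1 + y) ^ k"
        using x by (intro order_trans[OF norm_poly_exp_monom_deriv_le] mult_left_mono power_mono) auto
    qed (use x C0 in \<open>auto intro!: mult_nonneg_nonneg\<close>)
    also have "\<dots> = M * (exp (y - x) * exp (2 * (x - y)))"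
      by (simp add: M_def mult_ac)
    also have "exp (y - x) * exp (2 * (x - y)) = exp (x - y)"
      by (simp add: exp_add[symmetric] algebra_simps)
    finally show ?thesis .
  qed
  have exp_int: "((\<lambda>x. M * exp (x - y)) has_integral M * (exp (y - y) - exp (0 - y))) {0..y}"
    using y by (intro has_integral_mult_right fundamental_theorem_of_calculus)
      (auto intro!: derivative_eq_intros simp flip: has_real_derivative_iff_has_vector_derivative)
  have "norm R \<le> M * (exp (y - y) - exp (0 - y))"
    using Henstock_Kurzweil_Integration.integral_norm_bound_integral[OF has_integral_integrable[OF F] has_integral_integrable[OF exp_int] F_le]
    by (simp only: integral_unique[OF F] integral_unique[OF exp_int])
  also have "\<dots> \<le> M * 1"
    using M by (intro mult_left_mono) auto
  finally have R: "norm R \<le> M"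
    by simp
  have yk: "0 < y ^ k"
    using y by simp
  have "norm (of_real (y ^ k) * riesz_mean l a (real k) y (s\<^sub>0 + w))
      \<le> norm (exp (- w * of_real y) * (of_real (y ^ k) * riesz_mean l a (real k) y s\<^sub>0)) + norm R"
    unfolding R_def by (rule norm_triangle_sub)
  also have "norm (exp (- w * of_real y) * (of_real (y ^ k) * riesz_mean l a (real k) y s\<^sub>0)) \<le> 1 * (y ^ k * C)"
    unfolding norm_mult norm_of_real abs_of_pos[OF yk] using y w yk
    by (intro mult_mono C order_refl) (auto simp: norm_exp_eq_Re)
  also note R
  \<comment> \<open>y >= 1 turns (1 + y)^k into at most 2^k y^k; the power of y then cancels and the
    bound is uniform in y.\<close>
  also have "M \<le> C * ((norm w + real k) ^ Suc k * (2 * y) ^ k)"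
    unfolding M_def using y C0 by (intro mult_left_mono power_mono) auto
  finally have "y ^ k * norm (riesz_mean l a (real k) y (s\<^sub>0 + w)) \<le> y ^ k * (C * (1 + 2 ^ k * (norm w + real k) ^ Suc k))"
    unfolding norm_mult norm_of_real abs_of_pos[OF yk] by (simp add: power_mult_distrib algebra_simps)
  then show ?thesis
    using yk by simp
qed

section \<open>From a Riesz germ to almost periodicity\<close>

lemma dirichlet_polynomial_vertical:
  assumes "finite N" "inj_on l N"
  shows "(\<Sum>n\<in>N. b n * exp (- of_real (l n) * Complex \<sigma> t))
    = (\<Sum>\<alpha>\<in>l ` N. (b (inv_into N l \<alpha>) * exp (- of_real (\<alpha> * \<sigma>))) * exp (- \<i> * of_real \<alpha> * of_real t))"
proof -
  have "exp (- of_real (l n) * Complex \<sigma> t) = exp (- of_real (l n * \<sigma>)) * exp (- \<i> * of_real (l n) * of_real t)" for n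
    by (simp add: Complex_eq exp_add[symmetric] algebra_simps)
  then show ?thesis
    using assms by (simp add: sum.reindex inv_into_f_f mult.assoc)
qed

lemma dirichlet_polynomial_holomorphic:
  "(\<lambda>s. \<Sum>n\<in>N. b n * exp (- of_real (l n) * s)) holomorphic_on A"
  by (intro holomorphic_intros)

lemma tendsto_riesz_factor: "((\<lambda>x::real. (1 - t / x) powr m) \<longlongrightarrow> 1) at_top"
proof -
  have "((\<lambda>x. 1 - t / x) \<longlongrightarrow> 1 - 0) at_top"
    by (intro tendsto_intros tendsto_divide_0[OF tendsto_const] filterlim_at_top_imp_at_infinity filterlim_ident)
  then have "((\<lambda>x. (1 - t / x) powr m) \<longlongrightarrow> (1 - 0) powr m) at_top"
    by (rule tendsto_powr) auto
  then show ?thesis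
    by simp
qed

lemma smear_riesz_mean:
  assumes l: "frequency l" and K: "integrable lborel K"
  shows "smear K X (riesz_mean l a m y) s
    = (\<Sum>n | l n < y. a n * exp (- of_real (l n) * s) * transform K (l n / X) * of_real ((1 - l n / y) powr m))"
proof -
  let ?E = "\<lambda>n u. of_real (K u) * exp (- of_real (l n) * (s + \<i> * of_real (u / X)))"
  have "integrable lborel (?E n)" for n
  proof -
    have "?E n u = exp (- of_real (l n) * s) * (of_real (K u) * exp (- \<i> * of_real (l n / X) * of_real u))" for u
      unfolding mult.left_commute[of "exp (- of_real (l n) * s)"] exp_add[symmetric] by (simp add: algebra_simps)
    then show ?thesis
      using integrable_mult_right[OF integrable_transform[OF K, of "l n / X"], of "exp (- of_real (l n) * s)"]
      by (simp only:)
  qed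
  note int = integrable_mult_right[OF this]
  have "smear K X (riesz_mean l a m y) s = (LINT u|lborel. (\<Sum>n | l n < y. (a n * of_real ((1 - l n / y) powr m)) * ?E n u))"
    unfolding smear_def riesz_mean_def sum_distrib_left by (simp only: mult_ac)
  also have "\<dots> = (\<Sum>n | l n < y. (a n * of_real ((1 - l n / y) powr m)) * (LINT u|lborel. ?E n u))"
    using int by (subst Bochner_Integration.integral_sum) (simp_all only: integral_mult_right_zero)
  also have "\<dots> = (\<Sum>n | l n < y. a n * exp (- of_real (l n) * s) * transform K (l n / X) * of_real ((1 - l n / y) powr m))"
    unfolding smear_exp[unfolded smear_def] by (simp only: mult_ac)
  finally show ?thesis .
qed

text \<open>The exponent \<open>k + 2\<close> makes the kernel decay fast enough to absorb the growth of order \<open>k + 1\<close>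
  of the Riesz means.\<close>

lemma smear_riesz_germ:
  assumes "bounded_holomorphic f B" and l: "frequency l" and k: "0 < k" and \<sigma>: "0 \<le> \<sigma>"
    and lim: "\<And>s. \<sigma> < Re s \<Longrightarrow> ((\<lambda>x. riesz_mean l a (real k) x s) \<longlongrightarrow> f s) at_top"
    and X: "0 < X" and s: "0 < Re s"
  shows "smear (fejer_kernel (k + 2)) X f s
    = (\<Sum>n | l n < real (k + 2) * X. a n * transform (fejer_kernel (k + 2)) (l n / X) * exp (- of_real (l n) * s))"
proof (rule right_half_plane_identity[where c = "\<sigma> + 3" and g = "smear (fejer_kernel (k + 2)) X f"])
  interpret bounded_holomorphic f B by fact
  let ?K = "fejer_kernel (k + 2)" and ?c = "LINT u|lborel. fejer u ^ (k + 2)"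
  have c: "0 < ?c"
    by (rule integral_fejer_power_pos) simp
  have K: "integrable lborel ?K" "\<And>u. 0 \<le> ?K u"
    using fejer_kernel[of "k + 2"] by auto
  show "smear ?K X f holomorphic_on right_half_plane 0"
    by (rule smear_holomorphic[OF K])
  show "(\<lambda>s. \<Sum>n | l n < real (k + 2) * X. a n * transform ?K (l n / X) * exp (- of_real (l n) * s))
      holomorphic_on right_half_plane 0"
    by (rule dirichlet_polynomial_holomorphic)
  fix t
  define s where "s = Complex (\<sigma> + 3) t"
  have Re_s: "Re s = \<sigma> + 3"
    by (simp add: s_def)
  \<comment> \<open>The means converge at this point and are therefore bounded there. The line
    \<open>\<sigma> + 3\<close> lies 2 further to the right, as
    \<open>riesz_mean_polynomial_bound\<close> demands.\<close>
  define s\<^sub>0 where "s\<^sub>0 = complex_of_real (\<sigma> + 1)"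
  obtain C where C: "0 \<le> C" "\<And>x. norm (riesz_mean l a (real k) x s\<^sub>0) \<le> C"
    using riesz_mean_bounded[OF l _ lim, of s\<^sub>0] by (auto simp: s\<^sub>0_def)
  define A where "A = norm (s - s\<^sub>0) + real k + 1 / X"
  have A: "0 \<le> A"
    using X by (simp add: A_def)
  let ?v = "\<lambda>u. \<i> * complex_of_real (u / X)"
  have bound: "norm (riesz_mean l a (real k) y (s + ?v u)) \<le> C * (1 + 2 ^ k * A ^ Suc k) * (1 + \<bar>u\<bar>) ^ Suc k"
    if "1 \<le> y" for y u
  proof -
    have "norm (riesz_mean l a (real k) y (s\<^sub>0 + (s + ?v u - s\<^sub>0)))
        \<le> C * (1 + 2 ^ k * (norm (s + ?v u - s\<^sub>0) + real k) ^ Suc k)"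
      using that by (intro riesz_mean_polynomial_bound l k C) (auto simp: Re_s s\<^sub>0_def)
    also have "\<dots> \<le> C * ((1 + 2 ^ k * A ^ Suc k) * (1 + \<bar>u\<bar>) ^ Suc k)"
    proof (rule mult_left_mono[OF _ C(1)])
      have "norm (s + ?v u - s\<^sub>0) \<le> norm (s - s\<^sub>0) + norm (?v u)"
        using norm_triangle_ineq[of "s - s\<^sub>0" "?v u"] by (simp only: add_diff_eq diff_add_eq)
      also have "norm (?v u) = 1 / X * \<bar>u\<bar>"
        unfolding norm_mult norm_of_real using X by simp
      also have "norm (s - s\<^sub>0) + 1 / X * \<bar>u\<bar> + real k \<le> A * (1 + \<bar>u\<bar>)"
      proof -
        have "0 \<le> (norm (s - s\<^sub>0) + real k) * \<bar>u\<bar> + 1 / X"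
          using X by simp
        then show ?thesis
          by (simp add: A_def algebra_simps)
      qed
      finally have "norm (s + ?v u - s\<^sub>0) + real k \<le> A * (1 + \<bar>u\<bar>)"
        by simp
      then have "(norm (s + ?v u - s\<^sub>0) + real k) ^ Suc k \<le> (A * (1 + \<bar>u\<bar>)) ^ Suc k"
        by (intro power_mono) auto
      then have "2 ^ k * (norm (s + ?v u - s\<^sub>0) + real k) ^ Suc k \<le> 2 ^ k * (A ^ Suc k * (1 + \<bar>u\<bar>) ^ Suc k)"
        unfolding power_mult_distrib by (intro mult_left_mono) auto
      moreover have "1 \<le> (1 + \<bar>u\<bar>) ^ Suc k"
        by (intro one_le_power) simp
      ultimately show "1 + 2 ^ k * (norm (s + ?v u - s\<^sub>0) + real k) ^ Suc k
          \<le> (1 + 2 ^ k * A ^ Suc k) * (1 + \<bar>u\<bar>) ^ Suc k"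
        unfolding distrib_right mult.assoc mult_1_left by (rule add_mono[rotated])
    qed
    finally show ?thesis
      by (simp only: add_diff_cancel_left' add_diff_eq mult.assoc)
  qed
  have "((\<lambda>y. smear ?K X (riesz_mean l a (real k) y) s) \<longlongrightarrow> smear ?K X f s) at_top"
    unfolding smear_def
  proof (rule integral_dominated_convergence_at_top[where
        w = "\<lambda>u. C * (1 + 2 ^ k * A ^ Suc k) / ?c * ((1 + \<bar>u\<bar>) ^ Suc k * fejer u ^ (k + 2))"])
    have [measurable]: "?K \<in> borel_measurable borel"
      using K(1) by auto
    have "0 < Re s"
      using Re_s \<sigma> by simp
    then have [measurable]: "(\<lambda>u. f (s + ?v u)) \<in> borel_measurable borel"
      by (rule measurable_vertical[OF holo])
    have "riesz_mean l a (real k) y holomorphic_on right_half_plane 0" for y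
      unfolding riesz_mean_def by (intro holomorphic_intros)
    from measurable_vertical[OF this \<open>0 < Re s\<close>]
    have [measurable]: "(\<lambda>u. riesz_mean l a (real k) y (s + ?v u)) \<in> borel_measurable borel" for y .
    show "(\<lambda>u. of_real (?K u) * f (s + ?v u)) \<in> borel_measurable lborel"
      by measurable
    show "(\<lambda>u. of_real (?K u) * riesz_mean l a (real k) y (s + ?v u)) \<in> borel_measurable lborel" for y
      by measurable
    show "integrable lborel (\<lambda>u. C * (1 + 2 ^ k * A ^ Suc k) / ?c * ((1 + \<bar>u\<bar>) ^ Suc k * fejer u ^ (k + 2)))"
      by (intro integrable_mult_right integrable_power_fejer) simp
    show "AE u in lborel. ((\<lambda>y. of_real (?K u) * riesz_mean l a (real k) y (s + ?v u)) \<longlongrightarrow> of_real (?K u) * f (s + ?v u)) at_top"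
      by (intro AE_I2 tendsto_mult tendsto_const lim) (simp add: Re_s)
    show "\<forall>\<^sub>F y in at_top. AE u in lborel. norm (of_real (?K u) * riesz_mean l a (real k) y (s + ?v u))
        \<le> C * (1 + 2 ^ k * A ^ Suc k) / ?c * ((1 + \<bar>u\<bar>) ^ Suc k * fejer u ^ (k + 2))"
      using eventually_ge_at_top[of 1]
    proof eventually_elim
      case (elim y)
      show ?case
      proof (rule AE_I2)
        fix u
        have "?K u * norm (riesz_mean l a (real k) y (s + ?v u))
            \<le> ?K u * (C * (1 + 2 ^ k * A ^ Suc k) * (1 + \<bar>u\<bar>) ^ Suc k)"
          by (rule mult_left_mono[OF bound[OF elim] K(2)])
        also have "\<dots> = C * (1 + 2 ^ k * A ^ Suc k) / ?c * ((1 + \<bar>u\<bar>) ^ Suc k * fejer u ^ (k + 2))"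
          unfolding fejer_kernel_def by simp
        finally show "norm (of_real (?K u) * riesz_mean l a (real k) y (s + ?v u))
            \<le> C * (1 + 2 ^ k * A ^ Suc k) / ?c * ((1 + \<bar>u\<bar>) ^ Suc k * fejer u ^ (k + 2))"
          by (simp only: norm_mult norm_of_real abs_of_nonneg[OF K(2)])
      qed
    qed
  qed
  \<comment> \<open>Once y reaches (k + 2) X, the support of the transform cuts the sum to an index
    set independent of y. Only the Riesz factors still move, and they tend to 1.\<close>
  moreover have "((\<lambda>y. smear ?K X (riesz_mean l a (real k) y) s)
      \<longlongrightarrow> (\<Sum>n | l n < real (k + 2) * X. a n * exp (- of_real (l n) * s) * transform ?K (l n / X) * of_real 1)) at_top"
  proof (rule Lim_transform_eventually)
    show "((\<lambda>y. \<Sum>n | l n < real (k + 2) * X. a n * exp (- of_real (l n) * s) * transform ?K (l n / X)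
        * of_real ((1 - l n / y) powr real k))
      \<longlongrightarrow> (\<Sum>n | l n < real (k + 2) * X. a n * exp (- of_real (l n) * s) * transform ?K (l n / X) * of_real 1)) at_top"
      by (intro tendsto_sum tendsto_mult tendsto_const tendsto_of_real tendsto_riesz_factor)
    show "\<forall>\<^sub>F y in at_top. (\<Sum>n | l n < real (k + 2) * X. a n * exp (- of_real (l n) * s) * transform ?K (l n / X)
        * of_real ((1 - l n / y) powr real k)) = smear ?K X (riesz_mean l a (real k) y) s"
      using eventually_ge_at_top[of "real (k + 2) * X"]
    proof eventually_elim
      case (elim y)
      have "transform ?K (l n / X) = 0" if "real (k + 2) * X \<le> l n" for n
      proof -
        have "real (k + 2) \<le> \<bar>l n / X\<bar>"
          using that X by (intro order_trans[OF _ abs_ge_self]) (simp only: le_divide_eq if_True)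
        then have "transform (\<lambda>u. fejer u ^ (k + 2)) (l n / X) = 0"
          by (intro transform_fejer_power_eq_0) simp_all
        then show ?thesis
          by (simp only: transform_fejer_kernel div_0)
      qed
      then show ?case
        unfolding smear_riesz_mean[OF l K(1)] using elim
        by (intro sum.mono_neutral_left finite_frequency_less[OF l]) auto
    qed
  qed
  ultimately have "smear ?K X f s
      = (\<Sum>n | l n < real (k + 2) * X. a n * exp (- of_real (l n) * s) * transform ?K (l n / X) * of_real 1)"
    by (rule tendsto_unique[OF trivial_limit_at_top_linorder])
  then show "smear ?K X f (Complex (\<sigma> + 3) t) = (\<Sum>n | l n < real (k + 2) * X.
      a n * transform ?K (l n / X) * exp (- of_real (l n) * Complex (\<sigma> + 3) t))"
    by (simp add: s_def mult_ac)
qed (use \<sigma> s in auto)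

text \<open>On each line, averaging with large X gives uniform approximation by Dirichlet
  polynomials with frequencies in \<open>range l\<close>. That is almost periodicity; and for x
  outside \<open>range l\<close> every approximant has mean 0 against the exponential of frequency
  x, hence so does f.\<close>

lemma H_inf_0_subset_H_inf:
  assumes l: "frequency l"
  shows "H_inf_0 l \<subseteq> H_inf l"
proof
  fix f assume f: "f \<in> H_inf_0 l"
  then have holo: "f holomorphic_on right_half_plane 0" and bdd: "bounded (f ` right_half_plane 0)"
    by (auto simp: H_inf_0_def)
  obtain B where B: "bounded_holomorphic f B"
    using bounded_holomorphicI[OF holo bdd] .
  interpret bounded_holomorphic f B by fact
  obtain a m \<sigma> where m: "0 \<le> m" and \<sigma>: "0 \<le> \<sigma>"
    and lim: "\<And>s. \<sigma> < Re s \<Longrightarrow> ((\<lambda>x. riesz_mean l a m x s) \<longlongrightarrow> f s) at_top"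
    using f by (auto simp: H_inf_0_def riesz_germ_def right_half_plane_def)
  \<comment> \<open>Strictly above m, because raising the order takes a positive increment.\<close>
  define k where "k = nat \<lceil>m\<rceil> + 1"
  have "m < real k"
    unfolding k_def by linarith
  then have lim_k: "((\<lambda>x. riesz_mean l a (real k) x s) \<longlongrightarrow> f s) at_top" if "\<sigma> < Re s" for s
    using riesz_mean_raise[OF l m _ lim[OF that], of "real k - m"] by simp
  have "0 < k"
    by (simp add: k_def)
  let ?K = "fejer_kernel (k + 2)"
  have smear: "smear ?K X f s
      = (\<Sum>n | l n < real (k + 2) * X. a n * transform ?K (l n / X) * exp (- of_real (l n) * s))"
    if "0 < X" "0 < Re s" for X s
    by (rule smear_riesz_germ[OF B l \<open>0 < k\<close> \<sigma> _ that]) (rule lim_k)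
  have K: "integrable lborel ?K" "\<And>u. 0 \<le> ?K u" "(LINT u|lborel. ?K u) = 1"
    using fejer_kernel[of "k + 2"] by auto
  have inj: "inj_on l N" for N
    using l strict_mono_imp_inj_on[of l] inj_on_subset by (auto simp: frequency_def)
  have approx: "\<exists>A c. finite A \<and> A \<subseteq> range l \<and>
      (\<forall>t. norm (f (Complex \<tau> t) - (\<Sum>\<alpha>\<in>A. c \<alpha> * exp (- \<i> * of_real \<alpha> * of_real t))) \<le> e)"
    if \<tau>: "0 < \<tau>" and e: "0 < e" for \<tau> e :: real
  proof -
    obtain X where X: "0 < X" "\<And>s. \<tau> \<le> Re s \<Longrightarrow> norm (smear ?K X f s - f s) \<le> e"
      using eventually_happens'[OF trivial_limit_at_top_linorder
          eventually_conj[OF eventually_gt_at_top[of "0::real"] smear_approx[OF K \<tau> e]]] by blast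
    let ?N = "{n. l n < real (k + 2) * X}"
    have "finite ?N"
      by (rule finite_frequency_less[OF l])
    have "norm (f (Complex \<tau> t) - (\<Sum>n\<in>?N. a n * transform ?K (l n / X) * exp (- of_real (l n) * Complex \<tau> t))) \<le> e" for t
      using X(2)[of "Complex \<tau> t"] smear[OF X(1), of "Complex \<tau> t"] \<tau> by (simp add: norm_minus_commute)
    then show ?thesis
      unfolding dirichlet_polynomial_vertical[OF \<open>finite ?N\<close> inj] using \<open>finite ?N\<close>
      by (intro exI[of _ "l ` ?N"] exI[of _ "\<lambda>\<alpha>. (a (inv_into ?N l \<alpha>) * transform ?K (l (inv_into ?N l \<alpha>) / X)) * exp (- of_real (\<alpha> * \<tau>))"]) auto
  qed
  have uap: "uniformly_almost_periodic (\<lambda>t. f (Complex \<tau> t))" if "0 < \<tau>" for \<tau>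
    unfolding uniformly_almost_periodic_iff using approx[OF that] trig_polynomialI by blast
  have "bohr_coeff f \<tau> x = 0" if \<tau>: "0 < \<tau>" and x: "x \<notin> range l" for \<tau> x
  proof -
    have "has_mean (\<lambda>t. f (Complex \<tau> t) * exp (\<i> * of_real x * of_real t)) 0"
    proof (rule has_mean_approx)
      show "continuous_on UNIV (\<lambda>t. f (Complex \<tau> t) * exp (\<i> * of_real x * of_real t))"
        by (intro continuous_intros uniformly_almost_periodic_continuous[OF uap[OF \<tau>]])
    next
      fix e :: real assume e: "0 < e"
      obtain A c where A: "finite A" "A \<subseteq> range l"
        "\<And>t. norm (f (Complex \<tau> t) - (\<Sum>\<alpha>\<in>A. c \<alpha> * exp (- \<i> * of_real \<alpha> * of_real t))) \<le> e"
        using approx[OF \<tau> e] by blast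
      let ?p = "\<lambda>t. (\<Sum>\<alpha>\<in>A. c \<alpha> * exp (- \<i> * of_real \<alpha> * of_real t)) * exp (\<i> * of_real x * of_real t)"
      have "x \<notin> A"
        using A(2) x by blast
      then have "has_mean ?p 0"
        using has_mean_trig_polynomial_mult_exp[OF A(1), of c x] by simp
      moreover have "norm (f (Complex \<tau> t) * exp (\<i> * of_real x * of_real t) - ?p t) \<le> e" for t
        using A(3)[of t] by (simp add: left_diff_distrib[symmetric] norm_mult norm_exp_eq_Re)
      moreover have "continuous_on UNIV ?p"
        by (intro continuous_intros)
      ultimately show "\<exists>G d. continuous_on UNIV G \<and> has_mean G d \<and>
          (\<forall>t. norm (f (Complex \<tau> t) * exp (\<i> * of_real x * of_real t) - G t) \<le> e) \<and> norm (0 - d) \<le> e"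
        using e by (intro exI[of _ ?p] exI[of _ 0]) simp
    qed
    then show ?thesis
      using bohr_coeff_eq[of f \<tau> x 0] by simp
  qed
  with holo bdd uap show "f \<in> H_inf l"
    by (simp add: H_inf_def)
qed

section \<open>From almost periodicity to a Riesz germ\<close>

text \<open>Convolution with a nonnegative kernel of mass 1 contracts the supremum norm on the line
  and multiplies each coefficient by the transform. The same A and c serve f and its average, so
  that their Bohr coefficients can be compared.\<close>

lemma smear_almost_periodic:
  assumes "bounded_holomorphic f B" and uap: "uniformly_almost_periodic (\<lambda>t. f (Complex 1 t))"
    and K: "integrable lborel K" "\<And>u. 0 \<le> K u" "(LINT u|lborel. K u) = 1" and e: "0 < e"
  obtains A c where "finite A"
    "\<And>t. norm (f (Complex 1 t) - (\<Sum>\<alpha>\<in>A. c \<alpha> * exp (- \<i> * of_real \<alpha> * of_real t))) \<le> e"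
    "\<And>t. norm (smear K X f (Complex 1 t)
      - (\<Sum>\<alpha>\<in>A. (c \<alpha> * transform K (\<alpha> / X)) * exp (- \<i> * of_real \<alpha> * of_real t))) \<le> e"
proof -
  interpret bounded_holomorphic f B by fact
  obtain A c where A: "finite A"
    "\<And>t. norm (f (Complex 1 t) - (\<Sum>\<alpha>\<in>A. c \<alpha> * exp (- \<i> * of_real \<alpha> * of_real t))) \<le> e"
    using uniformly_almost_periodicE[OF uap e] by blast
  have "norm (smear K X f (Complex 1 t)
      - (\<Sum>\<alpha>\<in>A. (c \<alpha> * transform K (\<alpha> / X)) * exp (- \<i> * of_real \<alpha> * of_real t))) \<le> e" for t
  proof -
    let ?p = "\<lambda>u. \<Sum>\<alpha>\<in>A. c \<alpha> * exp (- \<i> * of_real \<alpha> * of_real (t + u / X))"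
    let ?E = "\<lambda>\<alpha> u. (c \<alpha> * exp (- \<i> * of_real \<alpha> * of_real t)) * (of_real (K u) * exp (- \<i> * of_real (\<alpha> / X) * of_real u))"
    have shift: "Complex 1 t + \<i> * of_real (u / X) = Complex 1 (t + u / X)" for u
      by (simp add: complex_eq_iff)
    have p_eq: "of_real (K u) * ?p u = (\<Sum>\<alpha>\<in>A. ?E \<alpha> u)" for u
    proof -
      have "exp (- \<i> * of_real \<alpha> * of_real (t + u / X))
          = exp (- \<i> * of_real \<alpha> * of_real t) * exp (- \<i> * of_real (\<alpha> / X) * of_real u)" for \<alpha>
        unfolding exp_add[symmetric] by (simp add: algebra_simps)
      then show ?thesis
        unfolding sum_distrib_left by (simp only: mult_ac)
    qed
    have E_int: "integrable lborel (?E \<alpha>)" for \<alpha>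
      by (rule integrable_mult_right[OF integrable_transform[OF K(1)]])
    have f_int: "integrable lborel (\<lambda>u. of_real (K u) * f (Complex 1 (t + u / X)))"
    proof -
      have "integrable lborel (\<lambda>u. of_real (K u) * f (Complex 1 t + \<i> * of_real (u / X)))"
        by (intro integrable_smear[OF K(1,2) holo, where C = B] bound) auto
      then show ?thesis
        by (simp only: shift)
    qed
    have p_int: "integrable lborel (\<lambda>u. of_real (K u) * ?p u)"
      unfolding p_eq by (rule Bochner_Integration.integrable_sum) (rule E_int)
    have "(LINT u|lborel. of_real (K u) * ?p u) = (\<Sum>\<alpha>\<in>A. LINT u|lborel. ?E \<alpha> u)"
      unfolding p_eq by (rule Bochner_Integration.integral_sum) (rule E_int)
    also have "\<dots> = (\<Sum>\<alpha>\<in>A. (c \<alpha> * transform K (\<alpha> / X)) * exp (- \<i> * of_real \<alpha> * of_real t))"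
      unfolding integral_mult_right_zero transform_def by (simp only: mult_ac)
    finally have "smear K X f (Complex 1 t)
        - (\<Sum>\<alpha>\<in>A. (c \<alpha> * transform K (\<alpha> / X)) * exp (- \<i> * of_real \<alpha> * of_real t))
        = (LINT u|lborel. of_real (K u) * f (Complex 1 (t + u / X)) - of_real (K u) * ?p u)"
      unfolding smear_def shift Bochner_Integration.integral_diff[OF f_int p_int] by (simp only:)
    also have "norm \<dots> \<le> (LINT u|lborel. K u * e)"
    proof (rule Bochner_Integration.integral_norm_bound_integral)
      show "integrable lborel (\<lambda>u. of_real (K u) * f (Complex 1 (t + u / X)) - of_real (K u) * ?p u)"
        by (rule Bochner_Integration.integrable_diff[OF f_int p_int])
      show "integrable lborel (\<lambda>u. K u * e)"
        using K(1) by simp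
      show "norm (of_real (K u) * f (Complex 1 (t + u / X)) - of_real (K u) * ?p u) \<le> K u * e" for u
        unfolding right_diff_distrib[symmetric] norm_mult norm_of_real abs_of_nonneg[OF K(2)]
        by (rule mult_left_mono[OF A(2) K(2)])
    qed
    also have "\<dots> = e"
      using K(3) by simp
    finally show ?thesis .
  qed
  with A show ?thesis
    by (rule that)
qed

text \<open>With the Bohr coefficients as series coefficients, the Riesz means of order 1 are the
  Fejer averages of f, and these converge to f on all of Re s > 0.\<close>

lemma H_inf_subset_H_inf_0:
  assumes l: "frequency l"
  shows "H_inf l \<subseteq> H_inf_0 l"
proof
  fix f assume f: "f \<in> H_inf l"
  then have holo: "f holomorphic_on right_half_plane 0" and bdd: "bounded (f ` right_half_plane 0)"
    and uap: "uniformly_almost_periodic (\<lambda>t. f (Complex 1 t))"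
    and spec: "\<And>x. x \<notin> range l \<Longrightarrow> bohr_coeff f 1 x = 0"
    by (auto simp: H_inf_def)
  obtain B where B: "bounded_holomorphic f B"
    using bounded_holomorphicI[OF holo bdd] .
  interpret bounded_holomorphic f B by fact
  let ?K = "fejer_kernel 1"
  have K: "integrable lborel ?K" "\<And>u. 0 \<le> ?K u" "(LINT u|lborel. ?K u) = 1"
    using fejer_kernel[of 1] by auto
  have inj: "inj_on l N" for N
    using l strict_mono_imp_inj_on[of l] inj_on_subset by (auto simp: frequency_def)
  define a where "a n = bohr_coeff f 1 (l n)" for n
  obtain b where b: "\<And>y. has_mean (\<lambda>t. f (Complex 1 t) * exp (\<i> * of_real y * of_real t)) (b y)"
    using uniformly_almost_periodic_has_mean[OF uap] by metis
  have bohr: "bohr_coeff f 1 y = exp (of_real y) * b y" for y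
    using bohr_coeff_eq[OF b[of y]] by simp
  then have b_zero: "b y = 0" if "y \<notin> range l" for y
    using spec[OF that] by simp
  have riesz: "smear ?K X f s = riesz_mean l a 1 X s" if X: "0 < X" and s: "0 < Re s" for X s
  proof (rule right_half_plane_identity[where c = 1 and g = "smear ?K X f" and h = "riesz_mean l a 1 X"])
    show "smear ?K X f holomorphic_on right_half_plane 0"
      by (rule smear_holomorphic[OF K(1,2)])
    show "riesz_mean l a 1 X holomorphic_on right_half_plane 0"
      unfolding riesz_mean_def by (intro holomorphic_intros)
    fix t
    let ?H = "\<lambda>t. smear ?K X f (Complex 1 t)" and ?N = "{n. l n < X}" and ?T = "\<lambda>y. transform ?K (y / X)"
    let ?S = "\<lambda>t. \<Sum>\<alpha>\<in>l ` ?N. (b \<alpha> * ?T \<alpha>) * exp (- \<i> * of_real \<alpha> * of_real t)"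
    have T_le: "norm (?T y) \<le> 1" for y
      unfolding transform_fejer_kernel_1 norm_of_real by simp
    have fin: "finite (l ` ?N)"
      using finite_frequency_less[OF l] by simp
    have H_approx: "\<exists>A c. finite A \<and> (\<forall>t. norm (f (Complex 1 t) - (\<Sum>\<alpha>\<in>A. c \<alpha> * exp (- \<i> * of_real \<alpha> * of_real t))) \<le> e)
        \<and> (\<forall>t. norm (?H t - (\<Sum>\<alpha>\<in>A. (c \<alpha> * ?T \<alpha>) * exp (- \<i> * of_real \<alpha> * of_real t))) \<le> e)" if "0 < e" for e
      by (rule smear_almost_periodic[OF B uap K that, of X]) blast
    have H_uap: "uniformly_almost_periodic ?H"
      unfolding uniformly_almost_periodic_iff
    proof (intro allI impI)
      fix e :: real assume "0 < e"
      from H_approx[OF this] obtain A c where A: "finite A"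
        "\<forall>t. norm (?H t - (\<Sum>\<alpha>\<in>A. (c \<alpha> * ?T \<alpha>) * exp (- \<i> * of_real \<alpha> * of_real t))) \<le> e"
        by blast
      then show "\<exists>p. trig_polynomial p \<and> (\<forall>t. norm (?H t - p t) \<le> e)"
        using trig_polynomialI[OF A(1), of "\<lambda>\<alpha>. c \<alpha> * ?T \<alpha>"] by (intro exI conjI)
    qed
    have H_mean: "has_mean (\<lambda>t. ?H t * exp (\<i> * of_real y * of_real t)) (b y * ?T y)" for y
    proof (rule has_mean_approx)
      show "continuous_on UNIV (\<lambda>t. ?H t * exp (\<i> * of_real y * of_real t))"
        by (intro continuous_intros uniformly_almost_periodic_continuous[OF H_uap])
    next
      fix e :: real assume "0 < e"
      then obtain A c where A: "finite A"
        "\<And>t. norm (f (Complex 1 t) - (\<Sum>\<alpha>\<in>A. c \<alpha> * exp (- \<i> * of_real \<alpha> * of_real t))) \<le> e"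
        "\<And>t. norm (?H t - (\<Sum>\<alpha>\<in>A. (c \<alpha> * ?T \<alpha>) * exp (- \<i> * of_real \<alpha> * of_real t))) \<le> e"
        using H_approx by blast
      let ?e = "\<lambda>t. exp (\<i> * of_real y * of_real t)"
      let ?p = "\<lambda>t. (\<Sum>\<alpha>\<in>A. c \<alpha> * exp (- \<i> * of_real \<alpha> * of_real t)) * ?e t"
      let ?q = "\<lambda>t. (\<Sum>\<alpha>\<in>A. (c \<alpha> * ?T \<alpha>) * exp (- \<i> * of_real \<alpha> * of_real t)) * ?e t"
      have cont: "continuous_on UNIV ?p" "continuous_on UNIV ?q" "continuous_on UNIV (\<lambda>t. f (Complex 1 t) * ?e t)"
        by (intro continuous_intros uniformly_almost_periodic_continuous[OF uap])+
      have "norm (f (Complex 1 t) * ?e t - ?p t) \<le> e" for t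
        using A(2)[of t] by (simp add: left_diff_distrib[symmetric] norm_mult norm_exp_eq_Re)
      \<comment> \<open>\<open>b y\<close> and the coefficient of the approximant differ by at most
        e, and multiplying by a transform of modulus at most 1 keeps this bound.\<close>
      from norm_mean_diff_le[OF b has_mean_trig_polynomial_mult_exp[OF A(1)] cont(3,1) this]
      have "norm (b y - (if y \<in> A then c y else 0)) * norm (?T y) \<le> e * 1"
        using T_le \<open>0 < e\<close> by (intro mult_mono) auto
      then have "norm (b y * ?T y - (if y \<in> A then c y * ?T y else 0)) \<le> e"
        unfolding norm_mult[symmetric] left_diff_distrib by (simp split: if_splits)
      moreover have "norm (?H t * ?e t - ?q t) \<le> e" for t
        using A(3)[of t] by (simp add: left_diff_distrib[symmetric] norm_mult norm_exp_eq_Re)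
      ultimately show "\<exists>G d. continuous_on UNIV G \<and> has_mean G d \<and>
          (\<forall>t. norm (?H t * ?e t - G t) \<le> e) \<and> norm (b y * ?T y - d) \<le> e"
        using cont(2) has_mean_trig_polynomial_mult_exp[OF A(1), of "\<lambda>\<alpha>. c \<alpha> * ?T \<alpha>" y]
        by (intro exI[of _ ?q] exI[of _ "if y \<in> A then c y * ?T y else 0"] conjI allI)
    qed
    have "?H t - ?S t = 0"
    proof (rule uniformly_almost_periodic_uniqueness[where F = "\<lambda>t. ?H t - ?S t"])
      show "uniformly_almost_periodic (\<lambda>t. ?H t - ?S t)"
        unfolding uniformly_almost_periodic_iff
      proof (intro allI impI)
        fix e :: real assume "0 < e"
        then obtain p where p: "trig_polynomial p" "\<And>t. norm (?H t - p t) \<le> e"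
          using H_uap unfolding uniformly_almost_periodic_iff by blast
        have "trig_polynomial (\<lambda>t. p t + (\<Sum>\<alpha>\<in>l ` ?N. (- (b \<alpha> * ?T \<alpha>)) * exp (- \<i> * of_real \<alpha> * of_real t)))"
          by (rule trig_polynomial_add[OF p(1) trig_polynomialI[OF fin]])
        then have "trig_polynomial (\<lambda>t. p t - ?S t)"
          by (simp only: mult_minus_left sum_negf diff_conv_add_uminus)
        moreover have "norm (?H t - ?S t - (p t - ?S t)) \<le> e" for t
          using p(2)[of t] by simp
        ultimately show "\<exists>p. trig_polynomial p \<and> (\<forall>t. norm (?H t - ?S t - p t) \<le> e)"
          by blast
      qed
      fix y
      \<comment> \<open>The two Bohr coefficients agree: at frequencies of l from X on the transform
        vanishes, and off \<open>range l\<close> the spectral hypothesis gives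
        \<open>b y = 0\<close>.\<close>
      have "b y * ?T y - (if y \<in> l ` ?N then b y * ?T y else 0) = 0"
      proof (cases "y \<in> range l \<and> X \<le> y")
        case True
        then have "?T y = 0"
          unfolding transform_fejer_kernel_1 using X by simp
        then show ?thesis
          by simp
      next
        case False
        then have "y \<in> l ` ?N \<or> y \<notin> range l"
          by auto
        then show ?thesis
          using b_zero by auto
      qed
      moreover have "has_mean (\<lambda>t. ?H t * exp (\<i> * of_real y * of_real t) - ?S t * exp (\<i> * of_real y * of_real t))
          (b y * ?T y - (if y \<in> l ` ?N then b y * ?T y else 0))"
        by (intro has_mean_diff H_mean has_mean_trig_polynomial_mult_exp fin continuous_intros
            uniformly_almost_periodic_continuous[OF H_uap])
      ultimately show "has_mean (\<lambda>t. (?H t - ?S t) * exp (\<i> * of_real y * of_real t)) 0"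
        by (simp only: left_diff_distrib)
    qed
    then have "?H t = ?S t"
      by simp
    also have "\<dots> = (\<Sum>n\<in>?N. (b (l n) * ?T (l n)) * exp (- \<i> * of_real (l n) * of_real t))"
      by (simp only: sum.reindex[OF inj] o_def)
    also have "\<dots> = riesz_mean l a 1 X (Complex 1 t)"
      unfolding riesz_mean_def
    proof (intro sum.cong refl)
      fix n assume "n \<in> ?N"
      moreover have "0 \<le> l n"
        using l by (simp add: frequency_def)
      ultimately have T: "?T (l n) = of_real ((1 - l n / X) powr 1)"
        unfolding transform_fejer_kernel_1 using X by simp
      \<comment> \<open>The factor e^(l n) contained in \<open>a n\<close>, which is computed on Re
        s = 1, cancels the decay e^(-l n) of the term on that line.\<close>
      have E: "exp (of_real (l n)) * exp (- of_real (l n) * Complex 1 t) = exp (- \<i> * of_real (l n) * of_real t)"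
        unfolding exp_add[symmetric] by (simp add: Complex_eq algebra_simps)
      show "(b (l n) * ?T (l n)) * exp (- \<i> * of_real (l n) * of_real t)
          = a n * exp (- of_real (l n) * Complex 1 t) * of_real ((1 - l n / X) powr 1)"
        unfolding T a_def bohr E[symmetric] by (simp only: mult_ac)
    qed
    finally show "?H t = riesz_mean l a 1 X (Complex 1 t)" .
  qed (use s in auto)
  have "((\<lambda>x. riesz_mean l a 1 x s) \<longlongrightarrow> f s) at_top" if s: "0 < Re s" for s
  proof (rule tendstoI)
    fix e :: real assume "0 < e"
    then have "0 < e / 2"
      by simp
    from smear_approx[OF K s this] eventually_gt_at_top[of "0::real"]
    show "\<forall>\<^sub>F x in at_top. dist (riesz_mean l a 1 x s) (f s) < e"
    proof eventually_elim
      case (elim X)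
      then have "norm (smear ?K X f s - f s) \<le> e / 2"
        by simp
      then show ?case
        using riesz[OF elim(2) s] \<open>0 < e\<close> by (simp add: dist_norm)
    qed
  qed
  then have "riesz_germ l a f"
    using holo unfolding riesz_germ_def
    by (intro conjI exI[of _ 1] exI[of _ 0]) (auto simp: right_half_plane_def)
  with holo bdd show "f \<in> H_inf_0 l"
    by (auto simp: H_inf_0_def)
qed

theorem corollary3p11:
  fixes l :: "nat \<Rightarrow> real"
  assumes "frequency l"
  shows "H_inf_0 l = H_inf l"
  using H_inf_0_subset_H_inf[OF assms] H_inf_subset_H_inf_0[OF assms] by (rule subset_antisym)

end
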